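(* Let $(M^n,\omega)$ be a compact Hermitian manifold of dimension $n\ge 2$, let $p$ be an integer with $2\le p\le n-1$, $N=\frac{n!}{p!(n-p)!}$, let $\Omega$ be a real $(p,p)$ form on $M$ and $\psi$ a function on $M$. Let $f$ be a smooth symmetric function defined in a symmetric open convex cone $\Gamma\subset\mathbb{R}^N$ with vertex at the origin containing the positive cone $\{\Lambda\in\mathbb{R}^N:\Lambda_i>0\ \forall i\}$. If $f_i=\frac{\partial f}{\partial\Lambda_i}\ge 0$ in $\Gamma$ for $1\le i\le N$, then the equation $$\frac{\partial\phi}{\partial t}=f\big(\Lambda(\Omega+\sqrt{-1}\,\partial\bar\partial\phi\wedge\omega^{p-1})\big)-\psi$$ is degenerate parabolic with respect to admissible solutions.
   Context: Eigenvalues of $(p,p)$ forms: let $\mathfrak{I}=\{(i_1,\dots,i_p):1\le i_1<\cdots<i_p\le n\}$ (with $N$ elements, ordered lexicographically). In local coordinates write $\omega=\sqrt{-1}g_{i\bar j}dz_i\wedge d\bar z_j$, $dz_I=dz_{i_1}\wedge\cdots\wedge dz_{i_p}$, so that $\omega^p=p!(\sqrt{-1})^{p^2}\sum\omega_{I\bar J}dz_I\wedge d\bar z_J$ with $\omega_{I\bar J}=\det(g_{i_k\bar j_l})_{i_k\in I,j_l\in J}$. For a real $(p,p)$ form $\Omega=p!(\sqrt{-1})^{p^2}\sum\Omega_{I\bar J}dz_I\wedge d\bar z_J$ the matrix $\{\Omega_{I\bar J}\}$ is Hermitian, and the eigenvalues $\Lambda(\Omega)=(\Lambda_1,\dots,\Lambda_N)$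 of $\Omega$ with respect to $\omega$ are the (real) roots $\lambda$ of $\det(\Omega_{I\bar J}-\lambda\omega_{I\bar J})=0$. A function $\phi$ is called admissible if $\Lambda(\Omega+\sqrt{-1}\partial\bar\partial\phi\wedge\omega^{p-1})\in\Gamma$ everywhere in $M\times\{t>0\}$. Degenerate parabolicity with respect to admissible solutions means: for real $(1,1)$ forms $\mathfrak{g}=\sqrt{-1}\,\mathfrak{g}_{i\bar j}dz_i\wedge d\bar z_j$ put $G(\mathfrak{g})=f(\Lambda(\Omega+\mathfrak{g}\wedge\omega^{p-1}))$ and $G^{i\bar j}=\partial G/\partial\mathfrak{g}_{i\bar j}$; then at $\mathfrak{g}=\sqrt{-1}\partial\bar\partial\phi$ for any admissible $\phi$, the Hermitian matrix $\{G^{i\bar j}\}$ is positive semi-definite at every point. *)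

theory Defs
  imports
    "HOL-Analysis.Analysis"
    "HOL-Library.List_Lexorder"
    "HOL-Computational_Algebra.Computational_Algebra"
    "Jordan_Normal_Form.Determinant"
begin

no_notation Matrix.vec_index (infixl "$" 100)

type_synonym 'n cmat = "complex^'n^'n"

section \<open>Differentiability on open sets\<close>

primrec Ck_on ::
  "nat \<Rightarrow> 'a::real_normed_vector set \<Rightarrow> ('a \<Rightarrow> 'b::real_normed_vector) \<Rightarrow> bool" where
  "Ck_on 0 S f \<longleftrightarrow> continuous_on S f"
| "Ck_on (Suc k) S f \<longleftrightarrow>
     (\<forall>x\<in>S. f differentiable (at x)) \<and> (\<forall>v. Ck_on k S (\<lambda>x. frechet_derivative f (at x) v))"

definition smooth_on :: "'a::real_normed_vector set \<Rightarrow> ('a \<Rightarrow> 'b::real_normed_vector) \<Rightarrow> bool" where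
  "smooth_on S f \<longleftrightarrow> (\<forall>k. Ck_on k S f)"

definition holomorphic_map_on :: "(complex^'n) set \<Rightarrow> (complex^'n \<Rightarrow> complex^'n) \<Rightarrow> bool" where
  "holomorphic_map_on S h \<longleftrightarrow>
     (\<forall>x\<in>S. \<exists>L. (h has_derivative L) (at x) \<and> (\<forall>c v. L (c *s v) = c *s L v))"

definition d_dz :: "'n \<Rightarrow> (complex^'n \<Rightarrow> complex) \<Rightarrow> complex^'n \<Rightarrow> complex" where
  "d_dz i u x =
     (frechet_derivative u (at x) (axis i 1) - \<i> * frechet_derivative u (at x) (axis i \<i>)) / 2"

definition d_dzbar :: "'n \<Rightarrow> (complex^'n \<Rightarrow> complex) \<Rightarrow> complex^'n \<Rightarrow> complex" where
  "d_dzbar i u x =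
     (frechet_derivative u (at x) (axis i 1) + \<i> * frechet_derivative u (at x) (axis i \<i>)) / 2"

definition complex_hessian :: "(complex^'n \<Rightarrow> real) \<Rightarrow> complex^'n \<Rightarrow> 'n::finite cmat" where
  "complex_hessian u x = (\<chi> i j. d_dz i (d_dzbar j (\<lambda>y. complex_of_real (u y))) x)"

section \<open>The exterior algebra of \<open>dz\<^sub>i\<close>, \<open>dzbar\<^sub>j\<close> at a point\<close>

text \<open>An element of the complex exterior algebra is given by its coefficients: \<open>\<alpha> I J\<close> is the
  coefficient of \<open>dz\<^sub>I \<and> dzbar\<^sub>J\<close>, the factors of \<open>dz\<^sub>I\<close> and of \<open>dzbar\<^sub>J\<close> each being taken in
  increasing order of the indices.\<close>

type_synonym 'n form = "'n set \<Rightarrow> 'n set \<Rightarrow> complex"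

text \<open>For disjoint \<open>A\<close>, \<open>B\<close>, \<open>dz\<^sub>A \<and> dz\<^sub>B = shuffle_sign A B * dz\<^sub>A\<^sub>\<union>\<^sub>B\<close>.\<close>

definition shuffle_sign :: "'n::{finite,linorder} set \<Rightarrow> 'n set \<Rightarrow> complex" where
  "shuffle_sign A B = (- 1) ^ card {(a, b). a \<in> A \<and> b \<in> B \<and> b < a}"

text \<open>The factor \<open>(- 1) ^ (card L * card (I - K))\<close> comes from moving \<open>dz\<^bsub>I - K\<^esub>\<close> past \<open>dzbar\<^sub>L\<close>.\<close>

definition wedge :: "'n::{finite,linorder} form \<Rightarrow> 'n form \<Rightarrow> 'n form" where
  "wedge \<alpha> \<beta> = (\<lambda>I J. \<Sum>K\<in>Pow I. \<Sum>L\<in>Pow J.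
     (- 1) ^ (card L * card (I - K)) * shuffle_sign K (I - K) * shuffle_sign L (J - L)
       * \<alpha> K L * \<beta> (I - K) (J - L))"

definition unit_form :: "'n form" where
  "unit_form = (\<lambda>I J. if I = {} \<and> J = {} then 1 else 0)"

definition dz :: "'n \<Rightarrow> 'n form" where
  "dz i = (\<lambda>I J. if I = {i} \<and> J = {} then 1 else 0)"

definition dzbar :: "'n \<Rightarrow> 'n form" where
  "dzbar j = (\<lambda>I J. if I = {} \<and> J = {j} then 1 else 0)"

definition form_add :: "'n form \<Rightarrow> 'n form \<Rightarrow> 'n form" where
  "form_add \<alpha> \<beta> = (\<lambda>I J. \<alpha> I J + \<beta> I J)"

definition wedge_list :: "'n::{finite,linorder} form list \<Rightarrow> 'n form" where
  "wedge_list \<alpha>s = foldr wedge \<alpha>s unit_form"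

definition wedge_power :: "'n::{finite,linorder} form \<Rightarrow> nat \<Rightarrow> 'n form" where
  "wedge_power \<alpha> k = wedge_list (replicate k \<alpha>)"

text \<open>Conjugation turns \<open>dz\<^sub>I \<and> dzbar\<^sub>J\<close> into \<open>dzbar\<^sub>I \<and> dz\<^sub>J\<close>, whence the sign.\<close>

definition form_conj :: "'n form \<Rightarrow> 'n form" where
  "form_conj \<alpha> = (\<lambda>I J. (- 1) ^ (card I * card J) * cnj (\<alpha> J I))"

definition real_pp_form :: "nat \<Rightarrow> 'n form \<Rightarrow> bool" where
  "real_pp_form p \<alpha> \<longleftrightarrow>
     (\<forall>I J. \<alpha> I J \<noteq> 0 \<longrightarrow> card I = p \<and> card J = p) \<and> form_conj \<alpha> = \<alpha>"

text \<open>The \<open>(1,1)\<close> form \<open>\<i> h\<^sub>i\<^sub>j dz\<^sub>i \<and> dzbar\<^sub>j\<close>.\<close>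

definition form11 :: "'n::{finite,linorder} cmat \<Rightarrow> 'n form" where
  "form11 h = (\<lambda>I J. \<i> * (\<Sum>i\<in>UNIV. \<Sum>j\<in>UNIV. h $ i $ j * wedge (dz i) (dzbar j) I J))"

text \<open>The substitution \<open>dz\<^sub>i \<mapsto> \<Sum>\<^sub>k a\<^sub>i\<^sub>k dw\<^sub>k\<close>, \<open>dzbar\<^sub>j \<mapsto> \<Sum>\<^sub>k cnj a\<^sub>j\<^sub>k dwbar\<^sub>k\<close>, extended to an
  algebra homomorphism.\<close>

definition substitute :: "'n::{finite,linorder} cmat \<Rightarrow> 'n form \<Rightarrow> 'n form" where
  "substitute a \<alpha> =
     (let \<theta> = (\<lambda>i K L. \<Sum>k\<in>UNIV. a $ i $ k * dz k K L);
          \<theta>bar = (\<lambda>j K L. \<Sum>k\<in>UNIV. cnj (a $ j $ k) * dzbar k K L)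
      in (\<lambda>K L. \<Sum>I\<in>UNIV. \<Sum>J\<in>UNIV. \<alpha> I J *
            wedge (wedge_list (map \<theta> (sorted_list_of_set I)))
                  (wedge_list (map \<theta>bar (sorted_list_of_set J))) K L))"

section \<open>Compact Hermitian manifolds\<close>

text \<open>The complex dimension is \<open>CARD('n)\<close>; the linear order on \<open>'n\<close> orders the coordinates. A chart
  is a pair of its domain and its coordinate map.\<close>

type_synonym ('m, 'n) chart = "'m set \<times> ('m \<Rightarrow> complex^'n)"

definition complex_atlas :: "'m topology \<Rightarrow> ('m, 'n::{finite,linorder}) chart set \<Rightarrow> bool" where
  "complex_atlas X A \<longleftrightarrow>
     (\<Union>(U, z)\<in>A. U) = topspace X \<and>
     (\<forall>(U, z)\<in>A. openin X U \<and> open (z ` U) \<and>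
        homeomorphic_map (subtopology X U) (top_of_set (z ` U)) z) \<and>
     (\<forall>(U, z)\<in>A. \<forall>(V, w)\<in>A. holomorphic_map_on (w ` (U \<inter> V)) (z \<circ> inv_into V w))"

definition compact_complex_manifold ::
  "'m topology \<Rightarrow> ('m, 'n::{finite,linorder}) chart set \<Rightarrow> bool" where
  "compact_complex_manifold X A \<longleftrightarrow>
     compact_space X \<and> Hausdorff_space X \<and> second_countable X \<and> complex_atlas X A"

definition jacobian :: "(complex^'n \<Rightarrow> complex^'n) \<Rightarrow> complex^'n \<Rightarrow> 'n::finite cmat" where
  "jacobian h x = (\<chi> i k. frechet_derivative h (at x) (axis k 1) $ i)"

text \<open>A form on \<open>M\<close> is given by its local expressions, one for each chart, which agree under the
  changes of coordinates.\<close>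

type_synonym ('m, 'n) form_field = "('m, 'n) chart \<Rightarrow> 'm \<Rightarrow> 'n form"

definition real_pp_form_on ::
  "('m, 'n::{finite,linorder}) chart set \<Rightarrow> nat \<Rightarrow> ('m, 'n) form_field \<Rightarrow> bool" where
  "real_pp_form_on A p \<alpha> \<longleftrightarrow>
     (\<forall>(U, z)\<in>A. (\<forall>x\<in>U. real_pp_form p (\<alpha> (U, z) x)) \<and>
        (\<forall>I J. smooth_on (z ` U) (\<lambda>y. \<alpha> (U, z) (inv_into U z y) I J))) \<and>
     (\<forall>(U, z)\<in>A. \<forall>(V, w)\<in>A. \<forall>x\<in>U \<inter> V.
        \<alpha> (V, w) x = substitute (jacobian (z \<circ> inv_into V w) (w x)) (\<alpha> (U, z) x))"

text \<open>\<open>metric_coeff \<omega> i j\<close> is \<open>g\<^sub>i\<^sub>j\<close> in \<open>\<omega> = \<i> g\<^sub>i\<^sub>j dz\<^sub>i \<and> dzbar\<^sub>j\<close>.\<close>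

definition metric_coeff :: "'n form \<Rightarrow> 'n \<Rightarrow> 'n \<Rightarrow> complex" where
  "metric_coeff \<omega> i j = \<omega> {i} {j} / \<i>"

definition hermitian_metric_on ::
  "('m, 'n::{finite,linorder}) chart set \<Rightarrow> ('m, 'n) form_field \<Rightarrow> bool" where
  "hermitian_metric_on A \<omega> \<longleftrightarrow> real_pp_form_on A 1 \<omega> \<and>
     (\<forall>(U, z)\<in>A. \<forall>x\<in>U. \<forall>\<xi>. \<xi> \<noteq> 0 \<longrightarrow>
        Re (\<Sum>i\<in>UNIV. \<Sum>j\<in>UNIV. metric_coeff (\<omega> (U, z) x) i j * \<xi> $ i * cnj (\<xi> $ j)) > 0)"

section \<open>Eigenvalues of \<open>(p,p)\<close> forms\<close>

text \<open>The strictly increasing \<open>p\<close>-tuples, in lexicographic order.\<close>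

definition multi_indices :: "nat \<Rightarrow> 'n::{finite,linorder} list list" where
  "multi_indices p = sorted_list_of_set {I. length I = p \<and> sorted_wrt (<) I}"

text \<open>\<open>\<Omega>\<^sub>I\<^sub>J\<close> in \<open>\<Omega> = p! \<i>\<^bsup>p\<^sup>2\<^esup> \<Sum> \<Omega>\<^sub>I\<^sub>J dz\<^sub>I \<and> dzbar\<^sub>J\<close>.\<close>

definition pp_coeff :: "nat \<Rightarrow> 'n form \<Rightarrow> 'n list \<Rightarrow> 'n list \<Rightarrow> complex" where
  "pp_coeff p \<Omega> I J = \<Omega> (set I) (set J) / (fact p * \<i> ^ p\<^sup>2)"

definition metric_minor :: "nat \<Rightarrow> 'n form \<Rightarrow> 'n list \<Rightarrow> 'n list \<Rightarrow> complex" where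
  "metric_minor p \<omega> I J =
     Determinant.det (Matrix.mat p p (\<lambda>(k, l). metric_coeff \<omega> (I ! k) (J ! l)))"

definition eigen_poly :: "nat \<Rightarrow> 'n::{finite,linorder} form \<Rightarrow> 'n form \<Rightarrow> complex poly" where
  "eigen_poly p \<omega> \<Omega> =
     (let \<II> = multi_indices p; N = length \<II>
      in Determinant.det (Matrix.mat N N (\<lambda>(a, b).
           [: pp_coeff p \<Omega> (\<II> ! a) (\<II> ! b), - metric_minor p \<omega> (\<II> ! a) (\<II> ! b) :])))"

text \<open>The eigenvalues are listed with multiplicity. The choice of their order is immaterial, as they
  are only used with a symmetric function and a symmetric cone. The intended index type \<open>'N\<close>
  has \<open>CARD('N) = CARD('n) choose p\<close>.\<close>

definition eigenvalues ::
  "nat \<Rightarrow> 'n::{finite,linorder} form \<Rightarrow> 'n form \<Rightarrow> real^'N" where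
  "eigenvalues p \<omega> \<Omega> =
     (SOME \<Lambda>. image_mset (\<lambda>i. complex_of_real (\<Lambda> $ i)) (mset_set UNIV) = proots (eigen_poly p \<omega> \<Omega>))"

section \<open>The flow\<close>

definition symmetric_set :: "(real^'N) set \<Rightarrow> bool" where
  "symmetric_set \<Gamma> \<longleftrightarrow> (\<forall>\<pi>. bij \<pi> \<longrightarrow> (\<forall>\<Lambda>\<in>\<Gamma>. (\<chi> i. \<Lambda> $ \<pi> i) \<in> \<Gamma>))"

definition symmetric_function_on :: "(real^'N) set \<Rightarrow> (real^'N \<Rightarrow> real) \<Rightarrow> bool" where
  "symmetric_function_on \<Gamma> f \<longleftrightarrow> (\<forall>\<pi>. bij \<pi> \<longrightarrow> (\<forall>\<Lambda>\<in>\<Gamma>. f (\<chi> i. \<Lambda> $ \<pi> i) = f \<Lambda>))"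

definition partial_deriv :: "(real^'N \<Rightarrow> real) \<Rightarrow> 'N \<Rightarrow> real^'N \<Rightarrow> real" where
  "partial_deriv f i \<Lambda> = frechet_derivative f (at \<Lambda>) (axis i 1)"

text \<open>The form \<open>\<Omega> + h \<and> \<omega>\<^bsup>p-1\<^esup>\<close>, \<open>h\<close> being given by its coefficient matrix.\<close>

definition perturbed ::
  "nat \<Rightarrow> 'n::{finite,linorder} form \<Rightarrow> 'n form \<Rightarrow> 'n::{finite,linorder} cmat \<Rightarrow> 'n form" where
  "perturbed p \<omega> \<Omega> h = form_add \<Omega> (wedge (form11 h) (wedge_power \<omega> (p - 1)))"

text \<open>Only the regularity needed for \<open>\<partial>\<partial>bar \<phi>\<close> is asked of \<open>\<phi>\<close>.\<close>

definition admissible ::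
  "('m, 'n::{finite,linorder}) chart set \<Rightarrow> nat \<Rightarrow> ('m, 'n) form_field \<Rightarrow> ('m, 'n) form_field
     \<Rightarrow> (real^'N) set \<Rightarrow> ('m \<Rightarrow> real \<Rightarrow> real) \<Rightarrow> bool" where
  "admissible A p \<omega> \<Omega> \<Gamma> \<phi> \<longleftrightarrow>
     (\<forall>(U, z)\<in>A. \<forall>t>0.
        Ck_on 2 (z ` U) (\<lambda>y. \<phi> (inv_into U z y) t) \<and>
        (\<forall>x\<in>U. eigenvalues p (\<omega> (U, z) x)
           (perturbed p (\<omega> (U, z) x) (\<Omega> (U, z) x)
              (complex_hessian (\<lambda>y. \<phi> (inv_into U z y) t) (z x))) \<in> \<Gamma>))"

text \<open>The right-hand side \<open>f(\<Lambda>(\<Omega> + h \<and> \<omega>\<^bsup>p-1\<^esup>)) - \<psi>\<close> of the flow at the point \<open>x\<close>, as a function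
  of \<open>h\<close>. It differs from \<open>G\<close> by a constant, so both have the same derivatives in \<open>h\<close>.\<close>

definition flow_rhs ::
  "nat \<Rightarrow> ('m, 'n::{finite,linorder}) form_field \<Rightarrow> ('m, 'n) form_field \<Rightarrow> (real^'N \<Rightarrow> real)
     \<Rightarrow> ('m \<Rightarrow> real) \<Rightarrow> ('m, 'n) chart \<Rightarrow> 'm \<Rightarrow> 'n cmat \<Rightarrow> real" where
  "flow_rhs p \<omega> \<Omega> f \<psi> c x h = f (eigenvalues p (\<omega> c x) (perturbed p (\<omega> c x) (\<Omega> c x) h)) - \<psi> x"

definition hermitian_mat :: "'n::finite cmat \<Rightarrow> bool" where
  "hermitian_mat h \<longleftrightarrow> (\<forall>i j. h $ j $ i = cnj (h $ i $ j))"

definition pos_semidefinite :: "'n::finite cmat \<Rightarrow> bool" where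
  "pos_semidefinite D \<longleftrightarrow> hermitian_mat D \<and>
     (\<forall>\<xi>. Re (\<Sum>i\<in>UNIV. \<Sum>j\<in>UNIV. D $ i $ j * \<xi> $ i * cnj (\<xi> $ j)) \<ge> 0)"

text \<open>\<open>D\<close> is the matrix of the partial derivatives \<open>G\<^sup>i\<^sup>j = \<partial>G/\<partial>h\<^sub>i\<^sub>j\<close> at \<open>h\<close>: \<open>G\<close>, as a function on the
  real vector space of Hermitian matrices, is differentiable with \<open>dG(k) = \<Sum> G\<^sup>i\<^sup>j k\<^sub>i\<^sub>j\<close>. Among
  Hermitian matrices \<open>D\<close> is unique, and the sum is then real.\<close>

definition has_gradient_matrix ::
  "('n::finite cmat \<Rightarrow> real) \<Rightarrow> 'n cmat \<Rightarrow> 'n cmat \<Rightarrow> bool" where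
  "has_gradient_matrix G D h \<longleftrightarrow> hermitian_mat D \<and>
     (G has_derivative (\<lambda>k. Re (\<Sum>i\<in>UNIV. \<Sum>j\<in>UNIV. D $ i $ j * k $ i $ j)))
       (at h within {k. hermitian_mat k})"

definition degenerate_parabolic_flow ::
  "('m, 'n::{finite,linorder}) chart set \<Rightarrow> nat \<Rightarrow> ('m, 'n) form_field \<Rightarrow> ('m, 'n) form_field
     \<Rightarrow> (real^'N \<Rightarrow> real) \<Rightarrow> (real^'N) set \<Rightarrow> ('m \<Rightarrow> real) \<Rightarrow> bool" where
  "degenerate_parabolic_flow A p \<omega> \<Omega> f \<Gamma> \<psi> \<longleftrightarrow>
     (\<forall>\<phi>. admissible A p \<omega> \<Omega> \<Gamma> \<phi> \<longrightarrow>
        (\<forall>(U, z)\<in>A. \<forall>x\<in>U. \<forall>t>0. \<exists>D.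
           has_gradient_matrix (flow_rhs p \<omega> \<Omega> f \<psi> (U, z) x) D
             (complex_hessian (\<lambda>y. \<phi> (inv_into U z y) t) (z x)) \<and>
           pos_semidefinite D))"

end

theory Submission
  imports Defs
begin

text \<open>
  Fix a chart and a point. Numbering the multi-indices, \<open>\<Omega> + h \<and> \<omega>\<^bsup>p-1\<^esup>\<close> becomes a Hermitian
  matrix \<open>A(h)\<close> that is affine in the Hermitian matrix \<open>h\<close>, and its eigenvalues are those of the pencil
  \<open>A(h) - \<lambda> W\<close>, where \<open>W\<close> is the matrix of \<open>p\<close>-minors of the metric. With the metric factored as
  \<open>g\<^sub>i\<^sub>j = \<Sum>\<^sub>s a\<^sub>i\<^sub>s cnj a\<^sub>j\<^sub>s\<close>, the Cauchy--Binet formula writes \<open>W\<close> as a sum of rank-one matrices and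
  shows that it is positive definite (\<open>metric_minor_pos_def\<close>). Hence \<open>A(h)\<close> has a \<open>W\<close>-orthonormal
  eigenbasis \<open>v\<close> with real eigenvalues \<open>\<mu>\<close> (\<open>pencil_eigenbasis\<close>).

  Individual eigenvalues are not differentiable where they cross, but a symmetric function of them is,
  with derivative \<open>K \<mapsto> \<Sum>\<^sub>a f\<^sub>a(\<mu>) K(v\<^sub>a, v\<^sub>a)\<close> (\<open>spectral_function_has_derivative\<close>). To see this,
  let \<open>u\<close>, \<open>l\<close> be an eigenbasis and the eigenvalues of the perturbed matrix \<open>A(h) + K\<close>. The transition matrix
  \<open>U\<^sub>a\<^sub>b = W(v\<^sub>a, u\<^sub>b)\<close> is unitary and satisfies \<open>K(v\<^sub>a, u\<^sub>b) = (l\<^sub>b - \<mu>\<^sub>a) U\<^sub>a\<^sub>b\<close>. As \<open>\<bar>det U\<bar> = 1\<close>,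
  some permutation makes all diagonal entries of \<open>U\<close> at least \<open>1 / N!\<close> in modulus, so for this
  order of the \<open>l\<^sub>b\<close> the differences \<open>l\<^sub>a - \<mu>\<^sub>a\<close> are \<open>O(\<bar>K\<bar>)\<close>. The same relation makes \<open>U\<^sub>a\<^sub>b\<close>
  of order \<open>O(\<bar>K\<bar>)\<close> whenever \<open>\<mu>\<^sub>a \<noteq> \<mu>\<^sub>b\<close>, while \<open>f\<^sub>a(\<mu>) = f\<^sub>b(\<mu>)\<close> whenever \<open>\<mu>\<^sub>a = \<mu>\<^sub>b\<close>. Since
  \<open>\<mu>\<^sub>a + K(v\<^sub>a, v\<^sub>a) = \<Sum>\<^sub>b l\<^sub>b \<bar>U\<^sub>a\<^sub>b\<bar>\<^sup>2\<close> with doubly stochastic weights \<open>\<bar>U\<^sub>a\<^sub>b\<bar>\<^sup>2\<close>, the sums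
  \<open>\<Sum>\<^sub>a f\<^sub>a(\<mu>) (l\<^sub>a - \<mu>\<^sub>a)\<close> and \<open>\<Sum>\<^sub>a f\<^sub>a(\<mu>) K(v\<^sub>a, v\<^sub>a)\<close> agree up to \<open>O(\<bar>K\<bar>\<^sup>2)\<close>.

  The gradient matrix \<open>D\<close> therefore satisfies
  \<open>\<Sum> D\<^sub>i\<^sub>j \<xi>\<^sub>i cnj \<xi>\<^sub>j = \<Sum>\<^sub>a f\<^sub>a(\<mu>) L(v\<^sub>a, v\<^sub>a)\<close>, where \<open>L\<close> is the coefficient matrix of
  \<open>\<i> \<xi> \<and> conj \<xi> \<and> \<omega>\<^bsup>p-1\<^esup>\<close>. The wedge product of a positive form with a positive \<open>(1,1)\<close> form is
  positive (\<open>nonneg_qq_wedge\<close>), so \<open>L\<close> is positive semidefinite, and \<open>f\<^sub>a \<ge> 0\<close> gives the claim.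
\<close>

no_notation fps_nth (infixl "$" 75)

section \<open>Sesquilinear forms and simultaneous diagonalisation\<close>

text \<open>The matrix \<open>B\<close> as a sesquilinear form, linear in the first argument. The index order is that of
  \<open>\<Sum> g\<^sub>i\<^sub>j \<xi>\<^sub>i cnj \<xi>\<^sub>j\<close> for a metric \<open>g\<close>, so eigenvectors below are eigenvectors of the transpose.\<close>

definition sesq :: "'k::finite cmat \<Rightarrow> complex^'k \<Rightarrow> complex^'k \<Rightarrow> complex" where
  "sesq B x y = (\<Sum>i\<in>UNIV. \<Sum>j\<in>UNIV. B $ i $ j * x $ i * cnj (y $ j))"

lemma sesq_add_left: "sesq B (x + x') y = sesq B x y + sesq B x' y"
  by (simp add: sesq_def distrib_left distrib_right sum.distrib)

lemma sesq_add_right: "sesq B x (y + y') = sesq B x y + sesq B x y'"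
  by (simp add: sesq_def distrib_left distrib_right sum.distrib)

lemma sesq_scale_left: "sesq B (c *s x) y = c * sesq B x y"
  by (simp add: sesq_def sum_distrib_left mult_ac)

lemma sesq_scale_right: "sesq B x (c *s y) = cnj c * sesq B x y"
  by (simp add: sesq_def sum_distrib_left mult_ac)

lemma sesq_scaleR_left: "sesq B (c *\<^sub>R x) y = of_real c * sesq B x y"
  by (simp add: sesq_def sum_distrib_left scaleR_conv_of_real[where 'a=complex] mult_ac)

lemma sesq_scaleR_right: "sesq B x (c *\<^sub>R y) = of_real c * sesq B x y"
  by (simp add: sesq_def sum_distrib_left scaleR_conv_of_real[where 'a=complex] mult_ac)

lemma sesq_zero_left [simp]: "sesq B 0 y = 0" and sesq_zero_right [simp]: "sesq B x 0 = 0"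
  by (simp_all add: sesq_def)

lemma sesq_sum_left: "sesq B (\<Sum>a\<in>S. g a) y = (\<Sum>a\<in>S. sesq B (g a) y)"
  by (induction S rule: infinite_finite_induct) (auto simp: sesq_add_left)

lemma sesq_sum_right: "sesq B x (\<Sum>a\<in>S. g a) = (\<Sum>a\<in>S. sesq B x (g a))"
  by (induction S rule: infinite_finite_induct) (auto simp: sesq_add_right)

lemma sesq_minus_right: "sesq B x (- y) = - sesq B x y"
  by (simp add: sesq_def sum_negf)

lemma sesq_diff_right: "sesq B x (y - y') = sesq B x y - sesq B x y'"
  using sesq_add_right[of B x y "- y'"] by (simp add: sesq_minus_right)

lemma sesq_add_mat: "sesq (B + C) x y = sesq B x y + sesq C x y"
  by (simp add: sesq_def distrib_left distrib_right sum.distrib)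

lemma sesq_diff_mat: "sesq (B - C) x y = sesq B x y - sesq C x y"
  by (simp add: sesq_def left_diff_distrib sum_subtractf)

lemma sesq_scaleR_mat: "sesq (c *\<^sub>R B) x y = of_real c * sesq B x y"
  by (simp add: sesq_def sum_distrib_left scaleR_conv_of_real[where 'a=complex] mult_ac)

lemma sesq_hermitian:
  assumes "hermitian_mat B"
  shows "sesq B y x = cnj (sesq B x y)"
proof -
  have "sesq B y x = (\<Sum>i\<in>UNIV. \<Sum>j\<in>UNIV. cnj (B $ j $ i * x $ j * cnj (y $ i)))"
    unfolding sesq_def
  proof (intro sum.cong refl)
    fix i j
    have "B $ i $ j = cnj (B $ j $ i)" using assms unfolding hermitian_mat_def by blast
    then show "B $ i $ j * y $ i * cnj (x $ j) = cnj (B $ j $ i * x $ j * cnj (y $ i))" by simp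
  qed
  also have "\<dots> = cnj (sesq B x y)"
    unfolding sesq_def by (subst sum.swap) simp
  finally show ?thesis .
qed

lemma sesq_hermitian_real:
  assumes "hermitian_mat B"
  shows "sesq B x x = of_real (Re (sesq B x x))"
  using sesq_hermitian[OF assms, of x x] by (simp add: complex_eq_iff)

lemma continuous_on_sesq: "continuous_on S (\<lambda>x. sesq B x x)"
  unfolding sesq_def by (intro continuous_intros)

lemma hermitian_mat_add: "hermitian_mat B \<Longrightarrow> hermitian_mat C \<Longrightarrow> hermitian_mat (B + C)"
  unfolding hermitian_mat_def vector_add_component complex_cnj_add
  by (intro allI arg_cong2[where f = "(+)"]) blast+

lemma hermitian_mat_minus: "hermitian_mat B \<Longrightarrow> hermitian_mat C \<Longrightarrow> hermitian_mat (B - C)"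
  unfolding hermitian_mat_def vector_minus_component complex_cnj_diff
  by (intro allI arg_cong2[where f = "(-)"]) blast+

lemma hermitian_mat_scaleR: "hermitian_mat B \<Longrightarrow> hermitian_mat (c *\<^sub>R B)"
  unfolding hermitian_mat_def vector_scaleR_component complex_cnj_scaleR
  by (intro allI arg_cong2[where f = scaleR] refl) blast

text \<open>If a Hermitian form is nonnegative along the complex line through \<open>y\<close> in the direction of a null
  vector \<open>x\<close>, then \<open>x\<close> and \<open>y\<close> are orthogonal: the restriction to the line is affine in the real parameter.\<close>

lemma sesq_nonneg_null:
  assumes B: "hermitian_mat B"
    and nn: "\<And>t c. Re (sesq B (y + (of_real t * c) *s x) (y + (of_real t * c) *s x)) \<ge> 0"
    and zero: "sesq B x x = 0"
  shows "sesq B x y = 0"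
proof (rule ccontr)
  assume ne: "sesq B x y \<noteq> 0"
  define q where "q = sesq B x y"
  define b where "b = Re (sesq B y y)"
  have "b + 2 * t * (cmod q)\<^sup>2 \<ge> 0" for t
  proof -
    let ?z = "of_real t * cnj q"
    have "sesq B (y + ?z *s x) (y + ?z *s x) = sesq B y y + (?z * q + cnj (?z * q))"
      using zero sesq_hermitian[OF B, of y x]
      by (simp add: sesq_add_left sesq_add_right sesq_scale_left sesq_scale_right q_def)
    moreover have "?z * q = of_real (t * (cmod q)\<^sup>2)"
      by (simp add: mult.assoc mult.commute[of "cnj q"] complex_norm_square[symmetric])
    ultimately have "Re (sesq B (y + ?z *s x) (y + ?z *s x)) = b + 2 * t * (cmod q)\<^sup>2"
      by (simp add: b_def)
    then show ?thesis using nn[of t "cnj q"] by simp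
  qed
  from this[of "- (\<bar>b\<bar> + 1) / (2 * (cmod q)\<^sup>2)"] have "b + (- (2 * \<bar>b\<bar>) - 2) / 2 \<ge> 0"
    using ne by (simp add: q_def)
  then have "\<bar>b\<bar> + 1 \<le> b" by (simp add: field_simps)
  then show False using abs_ge_self[of b] by linarith
qed

lemma exists_sesq_orthogonal:
  fixes W :: "'k::finite cmat" and v :: "'k \<Rightarrow> complex^'k"
  assumes S: "S \<noteq> (UNIV :: 'k set)"
  obtains x :: "complex^'k" where "x \<noteq> 0" "\<And>b. b \<in> S \<Longrightarrow> sesq W x (v b) = 0"
proof -
  \<comment> \<open>For the real inner product, \<open>sesq W x y = 0\<close> says that \<open>x\<close> is orthogonal to two vectors.\<close>
  define u where "u = (\<lambda>b. \<chi> i. cnj (\<Sum>j\<in>UNIV. W $ i $ j * cnj (v b $ j)))"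
  define T where "T = u ` S \<union> (\<lambda>b. \<i> *s u b) ` S"
  have "card T \<le> card S + card S"
    using card_Un_le[of "u ` S" "(\<lambda>b. \<i> *s u b) ` S"] card_image_le[OF finite, of u S]
      card_image_le[OF finite, of "\<lambda>b. \<i> *s u b" S]
    unfolding T_def by linarith
  also have "card S < CARD('k)" using S by (intro psubset_card_mono) auto
  then have "card S + card S < DIM(complex^'k)" by simp
  finally have "dim T < DIM(complex^'k)"
    using dim_le_card'[of T] by (simp add: T_def)
  then obtain x where x: "x \<noteq> 0" "\<And>y. y \<in> span T \<Longrightarrow> Linear_Algebra.orthogonal x y"
    using orthogonal_to_subspace_exists[of T] by metis
  have "sesq W x (v b) = 0" if "b \<in> S" for b
  proof -
    have 1: "sesq W x (v b) = (\<Sum>i\<in>UNIV. x $ i * cnj (u b $ i))"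
      by (simp add: sesq_def u_def sum_distrib_left mult_ac)
    have "x \<bullet> u b = 0" "x \<bullet> (\<i> *s u b) = 0"
      using x(2)[of "u b"] x(2)[of "\<i> *s u b"] that
      by (simp_all add: Linear_Algebra.orthogonal_def T_def span_base)
    moreover have "Re (x $ i * cnj (u b $ i)) = x $ i \<bullet> u b $ i"
      and "Im (x $ i * cnj (u b $ i)) = x $ i \<bullet> (\<i> * u b $ i)" for i
      by (simp_all add: inner_complex_def)
    ultimately have "Re (sesq W x (v b)) = 0" "Im (sesq W x (v b)) = 0"
      unfolding 1 Re_sum Im_sum by (simp_all add: inner_vec_def)
    then show ?thesis by (simp add: complex_eq_iff)
  qed
  with x(1) show thesis by (rule that)
qed

text \<open>The next eigenvector maximises the Rayleigh quotient on the complement of those already found.\<close>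

lemma sesq_orthonormal_extend:
  fixes H W :: "'k::finite cmat" and v :: "'k \<Rightarrow> complex^'k"
  assumes H: "hermitian_mat H" and W: "hermitian_mat W"
    and pos: "\<And>x. x \<noteq> 0 \<Longrightarrow> Re (sesq W x x) > 0"
    and S: "S \<noteq> UNIV"
    and orth: "\<And>a b. a \<in> S \<Longrightarrow> b \<in> S \<Longrightarrow> sesq W (v a) (v b) = (if a = b then 1 else 0)"
    and eig: "\<And>a y. a \<in> S \<Longrightarrow> sesq H (v a) y = of_real (\<mu> a) * sesq W (v a) y"
  shows "\<exists>x l. sesq W x x = 1 \<and> (\<forall>b\<in>S. sesq W x (v b) = 0) \<and>
    (\<forall>y. sesq H x y = of_real l * sesq W x y)"
proof -
  define E where "E = {x. \<forall>b\<in>S. sesq W x (v b) = 0}"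
  have E_lin: "x + c *s y \<in> E" if "x \<in> E" "y \<in> E" for x y c
    using that by (simp add: E_def sesq_add_left sesq_scale_left)
  have E_scaleR: "c *\<^sub>R x \<in> E" if "x \<in> E" for x c
    using that by (simp add: E_def sesq_scaleR_left)
  define q where "q = (\<lambda>x. Re (sesq H x x) / Re (sesq W x x))"
  have "closed E"
  proof -
    have "continuous_on UNIV (\<lambda>x. sesq W x (v b))" for b
      unfolding sesq_def by (intro continuous_intros)
    then have "closed {x. sesq W x (v b) = 0}" for b
      by (intro closed_Collect_eq) auto
    moreover have "E = (\<Inter>b\<in>S. {x. sesq W x (v b) = 0})" by (auto simp: E_def)
    ultimately show ?thesis by auto
  qed
  then have "compact (E \<inter> sphere 0 1)" by (simp add: closed_Int_compact)
  moreover have "E \<inter> sphere 0 1 \<noteq> {}"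
  proof -
    obtain x where "x \<noteq> 0" and x: "\<And>b. b \<in> S \<Longrightarrow> sesq W x (v b) = 0"
      using exists_sesq_orthogonal[OF S, of W v] by metis
    moreover have "x \<in> E" using x by (simp add: E_def)
    ultimately have "(1 / norm x) *\<^sub>R x \<in> E \<inter> sphere 0 1" using E_scaleR by simp
    then show ?thesis by blast
  qed
  moreover have "continuous_on (E \<inter> sphere 0 1) q"
    unfolding q_def
    by (intro continuous_on_divide continuous_on_Re continuous_on_sesq)
      (auto, metis pos norm_zero less_irrefl zero_neq_one)
  ultimately obtain x0 where x0: "x0 \<in> E \<inter> sphere 0 1" "\<And>y. y \<in> E \<inter> sphere 0 1 \<Longrightarrow> q y \<le> q x0"
    using continuous_attains_sup by metis
  define l where "l = q x0"
  have x0': "x0 \<in> E" "x0 \<noteq> 0" using x0(1) by auto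
  \<comment> \<open>\<open>Q\<close> is nonnegative on \<open>E\<close> and vanishes at the maximum point, so it annihilates \<open>x0\<close>.\<close>
  define Q where "Q = l *\<^sub>R W - H"
  have Q: "hermitian_mat Q" unfolding Q_def using H W by (intro hermitian_mat_minus hermitian_mat_scaleR)
  have Qs: "sesq Q x y = of_real l * sesq W x y - sesq H x y" for x y
    by (simp add: Q_def sesq_diff_mat sesq_scaleR_mat)
  have nn: "Re (sesq Q y y) \<ge> 0" if "y \<in> E" for y
  proof (cases "y = 0")
    case False
    define y' where "y' = (1 / norm y) *\<^sub>R y"
    have "y' \<in> E \<inter> sphere 0 1" using that False E_scaleR by (simp add: y'_def)
    then have "q y' \<le> l" using x0(2) by (simp add: l_def)
    moreover have "q y' = q y" using False
      by (simp add: q_def y'_def sesq_scaleR_left sesq_scaleR_right)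
    ultimately have "q y \<le> l" by simp
    then have "Re (sesq H y y) \<le> l * Re (sesq W y y)"
      using pos[OF False] by (simp add: q_def pos_divide_le_eq)
    then show ?thesis by (simp add: Qs)
  qed simp
  have zero: "sesq Q x0 x0 = 0"
  proof -
    have "Re (sesq Q x0 x0) = 0" using pos[OF x0'(2)] by (simp add: Qs l_def q_def)
    then show ?thesis using sesq_hermitian_real[OF Q, of x0] by simp
  qed
  have null: "sesq Q x0 y = 0" for y
  proof -
    \<comment> \<open>\<open>P\<close> is the projection of \<open>y\<close> to the span of the eigenvectors already found.\<close>
    define P where "P = (\<Sum>b\<in>S. sesq W y (v b) *s v b)"
    have PE: "y - P \<in> E"
    proof -
      have "sesq W P (v a) = sesq W y (v a)" if "a \<in> S" for a
      proof -
        have "sesq W (v a) P = (\<Sum>b\<in>S. cnj (sesq W y (v b)) * (if a = b then 1 else 0))"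
          unfolding P_def sesq_sum_right sesq_scale_right using that orth by (intro sum.cong) auto
        also have "\<dots> = cnj (sesq W y (v a))"
          using that by (simp add: if_distrib[of "\<lambda>z. _ * z"] cong: if_cong)
        finally show ?thesis using sesq_hermitian[OF W, of P "v a"] by simp
      qed
      then show ?thesis using sesq_add_left[of W y "-P"] unfolding E_def
        by (auto simp: sesq_def sum_negf)
    qed
    have "sesq Q x0 (y - P) = 0"
      by (rule sesq_nonneg_null[OF Q nn zero]) (intro E_lin PE x0')
    moreover have "sesq Q x0 P = 0"
    proof -
      have "sesq Q x0 (v b) = 0" if "b \<in> S" for b
      proof -
        have "sesq W x0 (v b) = 0" using that x0' by (simp add: E_def)
        then have "sesq W (v b) x0 = 0" using sesq_hermitian[OF W, of x0 "v b"] by simp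
        then have "sesq Q (v b) x0 = 0" by (simp add: Qs eig[OF that])
        then show ?thesis using sesq_hermitian[OF Q, of x0 "v b"] by simp
      qed
      then show ?thesis by (simp add: P_def sesq_sum_right sesq_scale_right)
    qed
    ultimately show ?thesis by (simp add: sesq_diff_right)
  qed
  define s where "s = sqrt (Re (sesq W x0 x0))"
  have s: "s > 0" "s * s = Re (sesq W x0 x0)" using pos[OF x0'(2)] by (simp_all add: s_def)
  define x where "x = (1 / s) *\<^sub>R x0"
  show ?thesis
  proof (rule exI[of _ x], rule exI[of _ l], intro conjI ballI allI)
    have "sesq W x x = of_real (Re (sesq W x0 x0) / (s * s))"
      by (subst of_real_divide, subst sesq_hermitian_real[OF W, symmetric])
         (simp add: x_def sesq_scaleR_left sesq_scaleR_right)
    then show "sesq W x x = 1" using s pos[OF x0'(2)] by simp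
    show "sesq W x (v b) = 0" if "b \<in> S" for b
      using x0'(1) that by (simp add: x_def sesq_scaleR_left E_def)
    show "sesq H x y = of_real l * sesq W x y" for y
      using null[of y] by (simp add: Qs x_def sesq_scaleR_left)
  qed
qed

text \<open>\<open>u\<close> is a \<open>W\<close>-orthonormal basis of eigenvectors of the pencil \<open>B - \<lambda> W\<close>, with eigenvalues \<open>\<mu>\<close>.
  It is a basis because its index type is that of the coordinates.\<close>

definition pencil_diag ::
  "'k::finite cmat \<Rightarrow> 'k cmat \<Rightarrow> ('k \<Rightarrow> complex^'k) \<Rightarrow> ('k \<Rightarrow> real) \<Rightarrow> bool" where
  "pencil_diag W B u \<mu> \<longleftrightarrow>
     (\<forall>a b. sesq W (u a) (u b) = (if a = b then 1 else 0)) \<and>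
     (\<forall>a y. sesq B (u a) y = of_real (\<mu> a) * sesq W (u a) y)"

lemma pencil_eigenbasis:
  fixes H W :: "'k::finite cmat"
  assumes H: "hermitian_mat H" and W: "hermitian_mat W"
    and pos: "\<And>x. x \<noteq> 0 \<Longrightarrow> Re (sesq W x x) > 0"
  shows "\<exists>v \<mu>. pencil_diag W H v \<mu>"
proof -
  have "\<exists>(v :: 'k \<Rightarrow> complex^'k) \<mu>. (\<forall>a\<in>S. \<forall>b\<in>S. sesq W (v a) (v b) = (if a = b then 1 else 0)) \<and>
           (\<forall>a\<in>S. \<forall>y. sesq H (v a) y = of_real (\<mu> a) * sesq W (v a) y)" for S :: "'k set"
    using finite[of S]
  proof (induction S rule: finite_induct)
    case (insert c S)
    from insert.IH obtain v \<mu> where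
      v: "\<And>a b. a \<in> S \<Longrightarrow> b \<in> S \<Longrightarrow> sesq W (v a) (v b) = (if a = b then 1 else 0)"
        "\<And>a y. a \<in> S \<Longrightarrow> sesq H (v a) y = of_real (\<mu> a) * sesq W (v a) y"
      by blast
    have "S \<noteq> UNIV" using insert.hyps by (metis UNIV_I)
    have "\<exists>x l. sesq W x x = 1 \<and> (\<forall>b\<in>S. sesq W x (v b) = 0) \<and>
        (\<forall>y. sesq H x y = of_real l * sesq W x y)"
      by (intro sesq_orthonormal_extend[where \<mu> = \<mu>] H W pos v \<open>S \<noteq> UNIV\<close>)
    then obtain x l where x: "sesq W x x = 1" "\<And>b. b \<in> S \<Longrightarrow> sesq W x (v b) = 0"
      "\<And>y. sesq H x y = of_real l * sesq W x y"
      by auto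
    have x': "sesq W (v b) x = 0" if "b \<in> S" for b
      using sesq_hermitian[OF W, of x "v b"] x(2)[OF that] by simp
    show ?case
      by (rule exI[of _ "v(c := x)"], rule exI[of _ "\<mu>(c := l)"]) (use v x x' insert.hyps in auto)
  qed auto
  from this[of UNIV] show ?thesis by (simp add: pencil_diag_def)
qed

lemma sesq_orthonormal_expansion:
  fixes W :: "'k::finite cmat" and u :: "'k \<Rightarrow> complex^'k"
  assumes u: "\<And>a b. sesq W (u a) (u b) = (if a = b then 1 else 0)"
  shows "x = (\<Sum>b\<in>UNIV. sesq W x (u b) *s u b)"
proof -
  define C :: "'k cmat" where "C = (\<chi> b k. u b $ k)"
  define D :: "'k cmat" where "D = (\<chi> i b. \<Sum>j\<in>UNIV. W $ i $ j * cnj (u b $ j))"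
  \<comment> \<open>Orthonormality says \<open>C D = 1\<close>, the expansion says \<open>D C = 1\<close>.\<close>
  have "C ** D = Finite_Cartesian_Product.mat 1"
  proof (intro Finite_Cartesian_Product.vec_eq_iff[THEN iffD2] allI)
    fix a b
    have "(C ** D) $ a $ b = sesq W (u a) (u b)"
      by (simp add: C_def D_def matrix_matrix_mult_def sesq_def sum_distrib_left mult_ac)
    then show "(C ** D) $ a $ b = Finite_Cartesian_Product.mat 1 $ a $ b"
      using u by (simp add: Finite_Cartesian_Product.mat_def)
  qed
  then have "D ** C = Finite_Cartesian_Product.mat 1" by (simp only: matrix_left_right_inverse)
  then have DC: "(\<Sum>b\<in>UNIV. D $ i $ b * C $ b $ k) = (if i = k then 1 else 0)" for i k
    by (simp add: Finite_Cartesian_Product.vec_eq_iff matrix_matrix_mult_def Finite_Cartesian_Product.mat_def)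
  have "(\<Sum>b\<in>UNIV. sesq W x (u b) *s u b) $ k = x $ k" for k
  proof -
    have "(\<Sum>b\<in>UNIV. sesq W x (u b) *s u b) $ k = (\<Sum>b\<in>UNIV. \<Sum>i\<in>UNIV. x $ i * (D $ i $ b * C $ b $ k))"
      by (simp add: C_def D_def sesq_def sum_distrib_left sum_distrib_right mult_ac)
    also have "\<dots> = (\<Sum>i\<in>UNIV. x $ i * (\<Sum>b\<in>UNIV. D $ i $ b * C $ b $ k))"
      by (subst sum.swap) (simp add: sum_distrib_left)
    also have "\<dots> = x $ k" by (simp add: DC if_distrib[of "\<lambda>z. _ * z"] cong: if_cong)
    finally show ?thesis .
  qed
  then show ?thesis by (simp add: Finite_Cartesian_Product.vec_eq_iff)
qed

lemma sesq_parseval: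
  fixes W :: "'k::finite cmat" and u :: "'k \<Rightarrow> complex^'k"
  assumes W: "hermitian_mat W"
    and u: "\<And>a b. sesq W (u a) (u b) = (if a = b then 1 else 0)"
  shows "sesq W x y = (\<Sum>b\<in>UNIV. sesq W x (u b) * cnj (sesq W y (u b)))"
proof -
  have "sesq W x y = sesq W (\<Sum>b\<in>UNIV. sesq W x (u b) *s u b) y"
    using sesq_orthonormal_expansion[of W u x, OF u] by simp
  also have "\<dots> = (\<Sum>b\<in>UNIV. sesq W x (u b) * sesq W (u b) y)"
    by (simp add: sesq_sum_left sesq_scale_left)
  also have "\<dots> = (\<Sum>b\<in>UNIV. sesq W x (u b) * cnj (sesq W y (u b)))"
    by (intro sum.cong refl arg_cong2[where f = "(*)"] sesq_hermitian[OF W])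
  finally show ?thesis .
qed

text \<open>The transition matrix between two orthonormal bases is unitary.\<close>

lemma sesq_orthonormal_transition:
  fixes W :: "'k::finite cmat" and u v :: "'k \<Rightarrow> complex^'k"
  assumes W: "hermitian_mat W"
    and v: "\<And>a b. sesq W (v a) (v b) = (if a = b then 1 else 0)"
    and u: "\<And>a b. sesq W (u a) (u b) = (if a = b then 1 else 0)"
  shows "(\<Sum>b\<in>UNIV. (cmod (sesq W (v a) (u b)))\<^sup>2) = 1"
    and "(\<Sum>a\<in>UNIV. (cmod (sesq W (v a) (u b)))\<^sup>2) = 1"
    and "cmod (sesq W (v a) (u b)) \<le> 1"
proof -
  have row: "(\<Sum>b\<in>UNIV. (cmod (sesq W (v a) (u b)))\<^sup>2) = 1"
    if v: "\<And>a b. sesq W (v a) (v b) = (if a = b then 1 else 0)"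
      and u: "\<And>a b. sesq W (u a) (u b) = (if a = b then 1 else 0)" for u v :: "'k \<Rightarrow> complex^'k" and a
  proof -
    have "complex_of_real (\<Sum>b\<in>UNIV. (cmod (sesq W (v a) (u b)))\<^sup>2) = sesq W (v a) (v a)"
      by (subst sesq_parseval[OF W u]) (simp only: of_real_sum complex_norm_square)
    also have "\<dots> = complex_of_real 1" using v by simp
    finally show ?thesis by (simp only: of_real_eq_iff)
  qed
  show r: "(\<Sum>b\<in>UNIV. (cmod (sesq W (v a) (u b)))\<^sup>2) = 1" by (rule row[OF v u])
  have "cmod (sesq W (v a) (u b)) = cmod (sesq W (u b) (v a))" for a
    using sesq_hermitian[OF W, of "u b" "v a"] by simp
  then show "(\<Sum>a\<in>UNIV. (cmod (sesq W (v a) (u b)))\<^sup>2) = 1"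
    using row[OF u v, of b] by simp
  have "(cmod (sesq W (v a) (u b)))\<^sup>2 \<le> (\<Sum>b\<in>UNIV. (cmod (sesq W (v a) (u b)))\<^sup>2)"
    by (rule member_le_sum) auto
  then show "cmod (sesq W (v a) (u b)) \<le> 1"
    using r by (simp add: power2_le_iff_abs_le[of 1, simplified])
qed

section \<open>First-order perturbation of symmetric functions of eigenvalues\<close>

text \<open>The transition matrix has determinant of modulus 1, so one term of the Leibniz formula is
  at least \<open>1 / N!\<close> in modulus, and so is each of its factors, all of them being at most 1.\<close>

lemma exists_large_diagonal:
  fixes W :: "'k::finite cmat" and u v :: "'k \<Rightarrow> complex^'k"
  assumes W: "hermitian_mat W"
    and v: "\<And>a b. sesq W (v a) (v b) = (if a = b then 1 else 0)"
    and u: "\<And>a b. sesq W (u a) (u b) = (if a = b then 1 else 0)"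
  obtains \<pi> where "\<pi> permutes (UNIV :: 'k set)"
    "\<And>a. cmod (sesq W (v a) (u (\<pi> a))) \<ge> 1 / fact CARD('k)"
proof -
  define M :: "'k cmat" where "M = (\<chi> a b. sesq W (v a) (u b))"
  define M' :: "'k cmat" where "M' = (\<chi> a b. cnj (M $ b $ a))"
  have "M ** M' = Finite_Cartesian_Product.mat 1"
    using sesq_parseval[OF W u, symmetric] v
    by (simp add: Finite_Cartesian_Product.vec_eq_iff matrix_matrix_mult_def Finite_Cartesian_Product.mat_def M_def M'_def)
  then have "Determinants.det M * Determinants.det M' = 1" by (metis Determinants.det_mul det_I)
  moreover have "Determinants.det M' = cnj (Determinants.det M)"
  proof -
    have "Determinants.det M' = Determinants.det (\<chi> a b. cnj (M $ a $ b))"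
      by (subst Determinants.det_transpose[symmetric]) (simp add: M'_def Finite_Cartesian_Product.transpose_def)
    also have "\<dots> = cnj (Determinants.det M)" by (simp add: Determinants.det_def)
    finally show ?thesis .
  qed
  ultimately have "complex_of_real ((cmod (Determinants.det M))\<^sup>2) = complex_of_real 1"
    by (simp only: complex_norm_square of_real_1)
  then have det1: "cmod (Determinants.det M) = 1"
    by (simp only: of_real_eq_iff) (metis norm_ge_zero one_power2 power2_eq_imp_eq zero_le_one)
  have le1: "cmod (M $ a $ b) \<le> 1" for a b
    using sesq_orthonormal_transition(3)[OF W v u] by (simp add: M_def)
  let ?P = "{p. p permutes (UNIV :: 'k set)}"
  have "\<exists>p\<in>?P. \<forall>a. cmod (M $ a $ p a) \<ge> 1 / fact CARD('k)"
  proof (rule ccontr)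
    assume neg: "\<not> ?thesis"
    have small: "cmod (\<Prod>a\<in>UNIV. M $ a $ p a) < 1 / fact CARD('k)" if p: "p \<in> ?P" for p
    proof -
      obtain a where a: "cmod (M $ a $ p a) < 1 / fact CARD('k)"
        using neg p by (meson not_le)
      have "cmod (\<Prod>a\<in>UNIV. M $ a $ p a) = cmod (M $ a $ p a) * (\<Prod>b\<in>UNIV - {a}. cmod (M $ b $ p b))"
        by (simp add: prod.remove[of UNIV a] norm_mult prod_norm[symmetric])
      also have "\<dots> \<le> cmod (M $ a $ p a)"
        by (intro mult_left_le prod_le_1) (auto simp: le1)
      finally show ?thesis using a by simp
    qed
    have "cmod (Determinants.det M) \<le> (\<Sum>p\<in>?P. cmod (\<Prod>a\<in>UNIV. M $ a $ p a))"
      unfolding Determinants.det_def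
      by (rule sum_norm_le) (simp add: norm_mult sign_def)
    also have "\<dots> < (\<Sum>p\<in>?P. 1 / fact CARD('k))"
      by (intro sum_strict_mono) (auto simp: small finite_permutations intro!: exI[of _ id] permutes_id)
    also have "\<dots> = 1" by (simp add: card_permutations[of "UNIV :: 'k set" "CARD('k)"])
    finally show False using det1 by simp
  qed
  then show thesis using that by (auto simp: M_def)
qed

lemma pencil_diagD:
  assumes "pencil_diag W B u \<mu>"
  shows "sesq W (u a) (u b) = (if a = b then 1 else 0)"
    and "sesq B (u a) y = of_real (\<mu> a) * sesq W (u a) y"
  using assms by (auto simp: pencil_diag_def)

lemma pencil_diag_permute:
  assumes "pencil_diag W B u \<mu>" and "inj \<pi>"
  shows "pencil_diag W B (\<lambda>a. u (\<pi> a)) (\<lambda>a. \<mu> (\<pi> a))"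
  using assms by (auto simp: pencil_diag_def inj_eq)

lemma sesq_pencil_diag:
  assumes W: "hermitian_mat W" and u: "pencil_diag W B u l"
  shows "sesq B x y = (\<Sum>b\<in>UNIV. of_real (l b) * (sesq W x (u b) * cnj (sesq W y (u b))))"
proof -
  have "sesq B x y = sesq B (\<Sum>b\<in>UNIV. sesq W x (u b) *s u b) y"
    using sesq_orthonormal_expansion[of W u x] pencil_diagD(1)[OF u] by simp
  also have "\<dots> = (\<Sum>b\<in>UNIV. sesq W x (u b) * (of_real (l b) * sesq W (u b) y))"
    by (simp add: sesq_sum_left sesq_scale_left pencil_diagD(2)[OF u])
  also have "\<dots> = (\<Sum>b\<in>UNIV. of_real (l b) * (sesq W x (u b) * cnj (sesq W y (u b))))"
    by (intro sum.cong refl) (simp add: sesq_hermitian[OF W, of y] mult_ac)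
  finally show ?thesis .
qed

lemma pencil_diag_difference:
  assumes W: "hermitian_mat W" and B: "hermitian_mat B"
    and v: "pencil_diag W H v \<mu>" and u: "pencil_diag W B u l"
  shows "sesq (B - H) (v a) (u b) = of_real (l b - \<mu> a) * sesq W (v a) (u b)"
proof -
  have "sesq B (v a) (u b) = cnj (sesq B (u b) (v a))"
    by (rule sesq_hermitian[OF B])
  also have "\<dots> = of_real (l b) * sesq W (v a) (u b)"
    using sesq_hermitian[OF W, of "v a" "u b"] by (simp add: pencil_diagD(2)[OF u])
  finally show ?thesis
    by (simp add: sesq_diff_mat pencil_diagD(2)[OF v] left_diff_distrib)
qed

text \<open>The second-order error of the first-order perturbation formula, for eigenvalues \<open>l\<close> listed in an
  order close to \<open>\<mu>\<close>. Pairs with \<open>\<mu> a = \<mu> b\<close> do not contribute, since then \<open>c a = c b\<close>; the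
  division by zero in the bound is harmless for the same reason.\<close>

lemma pencil_diag_first_order:
  fixes W H B :: "'k::finite cmat" and c :: "'k \<Rightarrow> real"
  assumes W: "hermitian_mat W" and B: "hermitian_mat B"
    and v: "pencil_diag W H v \<mu>" and u: "pencil_diag W B u l"
    and c: "\<And>a b. \<mu> a = \<mu> b \<Longrightarrow> c a = c b"
    and \<kappa>: "\<And>a b. cmod (sesq (B - H) (v a) (u b)) \<le> \<kappa>"
    and M: "M \<ge> 0" "\<And>a. \<bar>l a - \<mu> a\<bar> \<le> M * \<kappa>" and \<kappa>1: "\<kappa> \<le> 1"
  shows "\<bar>(\<Sum>a\<in>UNIV. c a * (l a - \<mu> a)) - (\<Sum>a\<in>UNIV. c a * Re (sesq (B - H) (v a) (v a)))\<bar>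
    \<le> (\<Sum>a\<in>UNIV. \<Sum>b\<in>UNIV. \<bar>c b - c a\<bar> * (\<bar>\<mu> b\<bar> + M) * ((1 + M) / \<bar>\<mu> b - \<mu> a\<bar>)\<^sup>2) * \<kappa>\<^sup>2"
proof -
  \<comment> \<open>a doubly stochastic matrix\<close>
  define w where "w = (\<lambda>a b. (cmod (sesq W (v a) (u b)))\<^sup>2)"
  note on = pencil_diagD(1)[OF v] pencil_diagD(1)[OF u]
  have w: "(\<Sum>b\<in>UNIV. w a b) = 1" "(\<Sum>a\<in>UNIV. w a b) = 1" for a b
    using sesq_orthonormal_transition[OF W on] by (auto simp: w_def)
  have \<kappa>0: "\<kappa> \<ge> 0" using \<kappa>[of undefined undefined] norm_ge_zero order_trans by blast
  have diag: "Re (sesq (B - H) (v a) (v a)) = (\<Sum>b\<in>UNIV. l b * w a b) - \<mu> a" for a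
  proof -
    have "sesq B (v a) (v a) = of_real (\<Sum>b\<in>UNIV. l b * w a b)"
      unfolding sesq_pencil_diag[OF W u] w_def of_real_sum of_real_mult complex_norm_square ..
    moreover have "sesq H (v a) (v a) = of_real (\<mu> a)"
      using pencil_diagD[OF v] by simp
    ultimately show ?thesis by (simp add: sesq_diff_mat)
  qed
  have "(\<Sum>a\<in>UNIV. c a * (l a - \<mu> a)) - (\<Sum>a\<in>UNIV. c a * Re (sesq (B - H) (v a) (v a)))
      = (\<Sum>b\<in>UNIV. c b * l b * (\<Sum>a\<in>UNIV. w a b)) - (\<Sum>a\<in>UNIV. c a * (\<Sum>b\<in>UNIV. l b * w a b))"
    by (simp add: diag w sum_subtractf right_diff_distrib)
  also have "(\<Sum>b\<in>UNIV. c b * l b * (\<Sum>a\<in>UNIV. w a b)) = (\<Sum>a\<in>UNIV. \<Sum>b\<in>UNIV. c b * l b * w a b)"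
    by (subst sum.swap) (simp add: sum_distrib_left)
  also have "(\<Sum>a\<in>UNIV. c a * (\<Sum>b\<in>UNIV. l b * w a b)) = (\<Sum>a\<in>UNIV. \<Sum>b\<in>UNIV. c a * l b * w a b)"
    by (simp add: sum_distrib_left mult_ac)
  also have "(\<Sum>a\<in>UNIV. \<Sum>b\<in>UNIV. c b * l b * w a b) - (\<Sum>a\<in>UNIV. \<Sum>b\<in>UNIV. c a * l b * w a b)
      = (\<Sum>a\<in>UNIV. \<Sum>b\<in>UNIV. (c b - c a) * l b * w a b)"
    by (simp add: sum_subtractf left_diff_distrib)
  also have "\<bar>\<dots>\<bar> \<le> (\<Sum>a\<in>UNIV. \<Sum>b\<in>UNIV. \<bar>c b - c a\<bar> * (\<bar>\<mu> b\<bar> + M) * ((1 + M) / \<bar>\<mu> b - \<mu> a\<bar>)\<^sup>2 * \<kappa>\<^sup>2)"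
  proof (intro order_trans[OF sum_abs] sum_mono)
    fix a b
    let ?U = "cmod (sesq W (v a) (u b))"
    show "\<bar>(c b - c a) * l b * w a b\<bar> \<le>
      \<bar>c b - c a\<bar> * (\<bar>\<mu> b\<bar> + M) * ((1 + M) / \<bar>\<mu> b - \<mu> a\<bar>)\<^sup>2 * \<kappa>\<^sup>2"
    proof (cases "\<mu> b = \<mu> a")
      case True
      then show ?thesis using c[OF True] by simp
    next
      case False
      have U1: "?U \<le> 1" by (rule sesq_orthonormal_transition(3)[OF W on])
      have "\<bar>\<mu> b - \<mu> a\<bar> * ?U \<le> \<bar>l b - \<mu> a\<bar> * ?U + \<bar>l b - \<mu> b\<bar> * ?U"
        by (subst distrib_right[symmetric], intro mult_right_mono) auto
      also have "\<bar>l b - \<mu> a\<bar> * ?U \<le> \<kappa>"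
        using \<kappa>[of a b] pencil_diag_difference[OF W B v u, of a b]
        by (simp add: norm_mult del: of_real_diff)
      also have "\<bar>l b - \<mu> b\<bar> * ?U \<le> (M * \<kappa>) * 1"
        using M \<kappa>0 U1 by (intro mult_mono) auto
      finally have "?U \<le> (1 + M) / \<bar>\<mu> b - \<mu> a\<bar> * \<kappa>"
        using False by (simp add: field_simps)
      then have "w a b \<le> ((1 + M) / \<bar>\<mu> b - \<mu> a\<bar> * \<kappa>)\<^sup>2"
        unfolding w_def by (intro power_mono) auto
      then have w': "w a b \<le> ((1 + M) / \<bar>\<mu> b - \<mu> a\<bar>)\<^sup>2 * \<kappa>\<^sup>2" by (simp only: power_mult_distrib)
      have "M * \<kappa> \<le> M" using M(1) \<kappa>1 by (simp add: mult_left_le)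
      then have "\<bar>l b\<bar> \<le> \<bar>\<mu> b\<bar> + M" using M(2)[of b] by linarith
      then have "\<bar>l b\<bar> * w a b \<le> (\<bar>\<mu> b\<bar> + M) * (((1 + M) / \<bar>\<mu> b - \<mu> a\<bar>)\<^sup>2 * \<kappa>\<^sup>2)"
        using w' M(1) by (intro mult_mono) (auto simp: w_def)
      then have "\<bar>c b - c a\<bar> * (\<bar>l b\<bar> * w a b) \<le>
          \<bar>c b - c a\<bar> * ((\<bar>\<mu> b\<bar> + M) * (((1 + M) / \<bar>\<mu> b - \<mu> a\<bar>)\<^sup>2 * \<kappa>\<^sup>2))"
        by (intro mult_left_mono) auto
      moreover have "\<bar>w a b\<bar> = w a b" by (simp add: w_def)
      ultimately show ?thesis by (simp add: abs_mult mult.assoc)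
    qed
  qed
  also have "\<dots> = (\<Sum>a\<in>UNIV. \<Sum>b\<in>UNIV. \<bar>c b - c a\<bar> * (\<bar>\<mu> b\<bar> + M) * ((1 + M) / \<bar>\<mu> b - \<mu> a\<bar>)\<^sup>2) * \<kappa>\<^sup>2"
    by (simp only: sum_distrib_right)
  finally show ?thesis .
qed

lemma bounded_linear_sesq_mat: "bounded_linear (\<lambda>B. sesq B x y)"
proof -
  have "linear (\<lambda>B. sesq B x y)"
    by (intro linearI) (simp_all add: sesq_add_mat sesq_scaleR_mat scaleR_conv_of_real[where 'a=complex])
  then show ?thesis by (simp add: linear_conv_bounded_linear)
qed

lemma frechet_derivative_partial_deriv:
  fixes f :: "real^'k \<Rightarrow> real"
  assumes "f differentiable (at x)"
  shows "(f has_derivative (\<lambda>y. \<Sum>a\<in>UNIV. partial_deriv f a x * y $ a)) (at x)"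
proof -
  let ?D = "frechet_derivative f (at x)"
  have D: "(f has_derivative ?D) (at x)" using assms frechet_derivative_works by blast
  then have lin: "linear ?D" using has_derivative_linear by blast
  have "?D y = (\<Sum>a\<in>UNIV. partial_deriv f a x * y $ a)" for y
  proof -
    have "y = (\<Sum>a\<in>UNIV. y $ a *\<^sub>R axis a 1)"
      using basis_expansion[of y] by (simp add: scalar_mult_eq_scaleR)
    then have "?D y = ?D (\<Sum>a\<in>UNIV. y $ a *\<^sub>R axis a 1)" by simp
    also have "\<dots> = (\<Sum>a\<in>UNIV. partial_deriv f a x * y $ a)"
      by (simp add: linear_sum[OF lin] linear_scale[OF lin] partial_deriv_def mult.commute)
    finally show ?thesis .
  qed
  then have "?D = (\<lambda>y. \<Sum>a\<in>UNIV. partial_deriv f a x * y $ a)" by blast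
  with D show ?thesis by simp
qed

text \<open>First-order expansion of a function of the eigenvalues at a matrix that may have multiple
  eigenvalues, where the assumption \<open>c\<close> replaces symmetry of \<open>f\<close>. The eigenvalues of the nearby matrix
  \<open>B\<close> are listed in an order close to \<open>\<mu>\<close>.\<close>

lemma spectral_function_first_order:
  fixes f :: "real^'k::finite \<Rightarrow> real" and W H :: "'k cmat"
  defines "c \<equiv> \<lambda>a \<mu>. partial_deriv f a (\<chi> i. \<mu> i)"
  assumes W: "hermitian_mat W" and pos: "\<And>x. x \<noteq> 0 \<Longrightarrow> Re (sesq W x x) > 0"
    and v: "pencil_diag W H v \<mu>"
    and \<Gamma>: "open \<Gamma>" "(\<chi> a. \<mu> a) \<in> \<Gamma>"
    and f: "f differentiable (at (\<chi> a. \<mu> a))"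
    and c: "\<And>a b. \<mu> a = \<mu> b \<Longrightarrow> c a \<mu> = c b \<mu>"
    and e: "e > 0"
  shows "\<exists>d>0. \<forall>B. hermitian_mat B \<longrightarrow> norm (B - H) < d \<longrightarrow>
    (\<exists>u l. pencil_diag W B u l \<and> (\<chi> a. l a) \<in> \<Gamma> \<and>
      \<bar>f (\<chi> a. l a) - f (\<chi> a. \<mu> a) - (\<Sum>a\<in>UNIV. c a \<mu> * Re (sesq (B - H) (v a) (v a)))\<bar>
        \<le> e * norm (B - H))"
proof -
  define x0 where "x0 = (\<chi> a. \<mu> a)"
  define c0 where "c0 = (\<lambda>a. c a \<mu>)"
  note on = pencil_diagD(1)[OF v]
  define M :: real where "M = fact CARD('k)"
  have M: "M > 0" by (simp add: M_def)
  \<comment> \<open>\<open>\<kappa> K\<close> measures \<open>K\<close> in the eigenbasis; the eigenvalues move by at most \<open>M * \<kappa> K\<close>.\<close>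
  define \<kappa> where "\<kappa> = (\<lambda>K. \<Sum>a\<in>UNIV. \<Sum>b\<in>UNIV. cmod (sesq K (v a) (v b)))"
  define C1 where "C1 = (\<Sum>a\<in>UNIV. \<Sum>b\<in>UNIV. onorm (\<lambda>K. sesq K (v a) (v b))) + 1"
  have C1: "C1 > 0"
    unfolding C1_def by (intro add_nonneg_pos sum_nonneg onorm_pos_le bounded_linear_sesq_mat) simp
  have \<kappa>0: "\<kappa> K \<ge> 0" for K unfolding \<kappa>_def by (intro sum_nonneg) auto
  have \<kappa>_le: "\<kappa> K \<le> C1 * norm K" for K
  proof -
    have "\<kappa> K \<le> (\<Sum>a\<in>UNIV. \<Sum>b\<in>UNIV. onorm (\<lambda>K. sesq K (v a) (v b)) * norm K)"
      unfolding \<kappa>_def by (intro sum_mono onorm bounded_linear_sesq_mat)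
    also have "\<dots> \<le> C1 * norm K" by (simp add: C1_def sum_distrib_right distrib_right)
    finally show ?thesis .
  qed
  define C where "C = (\<Sum>a\<in>UNIV. \<Sum>b\<in>UNIV.
    \<bar>c0 b - c0 a\<bar> * (\<bar>\<mu> b\<bar> + M) * ((1 + M) / \<bar>\<mu> b - \<mu> a\<bar>)\<^sup>2)"
  have C: "C \<ge> 0" unfolding C_def using M by (intro sum_nonneg mult_nonneg_nonneg) auto
  define L where "L = CARD('k) * M * C1"
  have L: "L \<ge> 0" using M C1 by (simp add: L_def)
  have f': "(f has_derivative (\<lambda>y. \<Sum>a\<in>UNIV. c0 a * y $ a)) (at x0)"
    using frechet_derivative_partial_deriv[OF f] by (simp add: c0_def c_def x0_def)
  obtain d0 where d0: "d0 > 0" "\<And>y. norm (y - x0) < d0 \<Longrightarrow> y \<in> \<Gamma>"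
    using \<Gamma> unfolding open_dist x0_def dist_norm by blast
    define e1 where "e1 = e / (2 * (L + 1))"
    have e1: "e1 > 0" using e L by (simp add: e1_def)
    obtain d1 where d1: "d1 > 0" "\<And>y. norm (y - x0) < d1 \<Longrightarrow>
        norm (f y - f x0 - (\<Sum>a\<in>UNIV. c0 a * (y - x0) $ a)) \<le> e1 * norm (y - x0)"
      using f' e1 unfolding has_derivative_within_alt by blast
    define d where "d = min (min d0 d1 / (L + 1)) (min (1 / C1) (e / (2 * (C * C1\<^sup>2 + 1))))"
    have CC: "C * C1\<^sup>2 + 1 > 0" using C by (simp add: add_nonneg_pos)
    have "d > 0" using d0 d1 L C1 e CC by (simp add: d_def)
    moreover have "\<exists>u l. pencil_diag W B u l \<and> (\<chi> a. l a) \<in> \<Gamma> \<and>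
      \<bar>f (\<chi> a. l a) - f (\<chi> a. \<mu> a) - (\<Sum>a\<in>UNIV. c a \<mu> * Re (sesq (B - H) (v a) (v a)))\<bar>
        \<le> e * norm (B - H)"
      if B: "hermitian_mat B" and Bd: "norm (B - H) < d" for B
    proof -
      let ?K = "B - H" let ?n = "norm (B - H)"
      have n1: "?n * (L + 1) < min d0 d1" and n2: "?n < 1 / C1" and n3: "?n < e / (2 * (C * C1\<^sup>2 + 1))"
        using Bd L by (auto simp: d_def pos_less_divide_eq)
      have k1: "\<kappa> ?K \<le> 1" using \<kappa>_le[of ?K] n2 C1 by (simp add: field_simps)
      obtain u0 l0 where u0: "pencil_diag W B u0 l0"
        using pencil_eigenbasis[OF B W pos] by blast
      obtain \<pi> where \<pi>: "\<pi> permutes (UNIV :: 'k set)"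
        "\<And>a. cmod (sesq W (v a) (u0 (\<pi> a))) \<ge> 1 / fact CARD('k)"
        using exists_large_diagonal[OF W on pencil_diagD(1)[OF u0]] by metis
      define u where "u = (\<lambda>a. u0 (\<pi> a))"
      define l where "l = (\<lambda>a. l0 (\<pi> a))"
      have u: "pencil_diag W B u l"
        unfolding u_def l_def by (rule pencil_diag_permute[OF u0 permutes_inj[OF \<pi>(1)]])
      have \<kappa>: "cmod (sesq ?K (v a) (u b)) \<le> \<kappa> ?K" for a b
      proof -
        have "sesq ?K (v a) (u b) = (\<Sum>i\<in>UNIV. cnj (sesq W (u b) (v i)) * sesq ?K (v a) (v i))"
          by (subst sesq_orthonormal_expansion[of W v "u b", OF on])
            (simp only: sesq_sum_right sesq_scale_right)
        also have "cmod \<dots> \<le> (\<Sum>i\<in>UNIV. 1 * cmod (sesq ?K (v a) (v i)))"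
          unfolding norm_mult complex_mod_cnj
          using sesq_orthonormal_transition(3)[OF W pencil_diagD(1)[OF u] on]
          by (intro order_trans[OF norm_sum] sum_mono) (auto simp: norm_mult intro!: mult_left_le_one_le)
        also have "\<dots> \<le> \<kappa> ?K"
          unfolding \<kappa>_def mult_1_left
          using member_le_sum[of a UNIV "\<lambda>a. \<Sum>i\<in>UNIV. cmod (sesq ?K (v a) (v i))"]
          by (simp add: sum_nonneg)
        finally show ?thesis .
      qed
      have lM: "\<bar>l a - \<mu> a\<bar> \<le> M * \<kappa> ?K" for a
      proof -
        have "\<bar>l a - \<mu> a\<bar> * (1 / M) \<le> \<bar>l a - \<mu> a\<bar> * cmod (sesq W (v a) (u a))"
          using \<pi>(2)[of a] by (intro mult_left_mono) (auto simp: M_def u_def)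
        also have "\<dots> \<le> \<kappa> ?K"
          using \<kappa>[of a a] pencil_diag_difference[OF W B v u, of a a]
          by (simp add: norm_mult del: of_real_diff)
        finally show ?thesis using M by (simp add: field_simps)
      qed
      define y where "y = (\<chi> a. l a)"
      have "norm (y - x0) \<le> (\<Sum>a\<in>UNIV. \<bar>(y - x0) $ a\<bar>)" by (rule norm_le_l1_cart)
      also have "\<dots> \<le> (\<Sum>a\<in>(UNIV::'k set). M * \<kappa> ?K)"
        by (intro sum_mono) (simp add: y_def x0_def lM)
      also have "\<dots> \<le> L * ?n"
        using mult_left_mono[OF \<kappa>_le[of ?K], of "CARD('k) * M"] M by (simp add: L_def mult_ac)
      finally have yn: "norm (y - x0) \<le> L * ?n" .
      also have "\<dots> \<le> ?n * (L + 1)" by (simp add: algebra_simps)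
      finally have yd: "norm (y - x0) < d0" "norm (y - x0) < d1" using n1 by auto
      have 1: "\<bar>f y - f x0 - (\<Sum>a\<in>UNIV. c0 a * (l a - \<mu> a))\<bar> \<le> e1 * norm (y - x0)"
        using d1(2)[OF yd(2)] by (simp add: y_def x0_def)
      also have "\<dots> \<le> e1 * ((L + 1) * ?n)"
        using yn e1 by (intro mult_left_mono) (auto simp: algebra_simps intro: order_trans)
      also have "\<dots> = e / 2 * ?n"
      proof -
        have "e / (2 * z) * (z * r) = e / 2 * r" if "z \<noteq> 0" for z r :: real using that by simp
        from this[of "L + 1"] show ?thesis using L by (simp only: e1_def)
      qed
      finally have 1: "\<bar>f y - f x0 - (\<Sum>a\<in>UNIV. c0 a * (l a - \<mu> a))\<bar> \<le> e / 2 * ?n" .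
      have "\<bar>(\<Sum>a\<in>UNIV. c0 a * (l a - \<mu> a)) - (\<Sum>a\<in>UNIV. c0 a * Re (sesq ?K (v a) (v a)))\<bar> \<le> C * (\<kappa> ?K)\<^sup>2"
        unfolding C_def
      proof (rule pencil_diag_first_order[OF W B v u])
        show "c0 a = c0 b" if "\<mu> a = \<mu> b" for a b
          using c[OF that] by (simp add: c0_def)
      qed (use \<kappa> lM k1 M in auto)
      also have "\<dots> \<le> C * (C1 * ?n)\<^sup>2"
        using C \<kappa>0 \<kappa>_le by (intro mult_left_mono power_mono) auto
      also have "\<dots> = (C * C1\<^sup>2 * ?n) * ?n" by (simp add: power2_eq_square)
      also have "\<dots> \<le> (e / 2) * ?n"
      proof (intro mult_right_mono norm_ge_zero)
        have "C * C1\<^sup>2 * ?n \<le> (C * C1\<^sup>2 + 1) * ?n" by (intro mult_right_mono) auto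
        also have "\<dots> \<le> e / 2" using n3 CC by (simp add: field_simps)
        finally show "C * C1\<^sup>2 * ?n \<le> e / 2" .
      qed
      finally have 2: "\<bar>(\<Sum>a\<in>UNIV. c0 a * (l a - \<mu> a)) - (\<Sum>a\<in>UNIV. c0 a * Re (sesq ?K (v a) (v a)))\<bar>
        \<le> e / 2 * ?n" .
      have "\<bar>f y - f x0 - (\<Sum>a\<in>UNIV. c0 a * Re (sesq ?K (v a) (v a)))\<bar> \<le> e / 2 * ?n + e / 2 * ?n"
        using 1 2 by linarith
      then have "\<bar>f y - f x0 - (\<Sum>a\<in>UNIV. c a \<mu> * Re (sesq ?K (v a) (v a)))\<bar> \<le> e * ?n"
        by (simp add: c0_def)
      with u d0(2)[OF yd(1)] show ?thesis unfolding y_def x0_def by blast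
    qed
    ultimately show ?thesis by blast
qed

text \<open>\<open>G\<close> is a function on \<open>S\<close> that depends only on the eigenvalues of the affine family \<open>A\<close> of
  Hermitian matrices, in whatever order they are listed.\<close>

lemma spectral_function_has_derivative:
  fixes f :: "real^'k::finite \<Rightarrow> real" and A :: "'a::real_normed_vector \<Rightarrow> 'k cmat"
  assumes W: "hermitian_mat W" and pos: "\<And>x. x \<noteq> 0 \<Longrightarrow> Re (sesq W x x) > 0"
    and A: "\<And>k. A k = A h + A' (k - h)" "bounded_linear A'"
    and herm: "\<And>k. k \<in> S \<Longrightarrow> hermitian_mat (A k)" and h: "h \<in> S"
    and v: "pencil_diag W (A h) v \<mu>"
    and \<Gamma>: "open \<Gamma>" "(\<chi> a. \<mu> a) \<in> \<Gamma>"
    and f: "f differentiable (at (\<chi> a. \<mu> a))"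
    and c: "\<And>a b. \<mu> a = \<mu> b \<Longrightarrow> partial_deriv f a (\<chi> i. \<mu> i) = partial_deriv f b (\<chi> i. \<mu> i)"
    and G: "\<And>k u l. k \<in> S \<Longrightarrow> pencil_diag W (A k) u l \<Longrightarrow> (\<chi> a. l a) \<in> \<Gamma> \<Longrightarrow> G k = f (\<chi> a. l a)"
  shows "(G has_derivative (\<lambda>k. \<Sum>a\<in>UNIV. partial_deriv f a (\<chi> i. \<mu> i) * Re (sesq (A' k) (v a) (v a))))
           (at h within S)"
  unfolding has_derivative_within_alt
proof (intro conjI allI impI)
  show "bounded_linear (\<lambda>k. \<Sum>a\<in>UNIV. partial_deriv f a (\<chi> i. \<mu> i) * Re (sesq (A' k) (v a) (v a)))"
    by (intro bounded_linear_sum bounded_linear_const_mult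
        bounded_linear_compose[OF bounded_linear_Re]
        bounded_linear_compose[OF bounded_linear_sesq_mat A(2)])
next
  fix e :: real assume e: "e > 0"
  obtain C where C: "C > 0" "\<And>k. norm (A' k) \<le> norm k * C"
    using bounded_linear.pos_bounded[OF A(2)] by blast
  have "e / C > 0" using e C by simp
  define P where "P = (\<lambda>B. \<exists>u l. pencil_diag W B u l \<and> (\<chi> a. l a) \<in> \<Gamma> \<and>
      \<bar>f (\<chi> a. l a) - f (\<chi> a. \<mu> a) - (\<Sum>a\<in>UNIV. partial_deriv f a (\<chi> i. \<mu> i) * Re (sesq (B - A h) (v a) (v a)))\<bar>
        \<le> e / C * norm (B - A h))"
  have "\<exists>d>0. \<forall>B. hermitian_mat B \<longrightarrow> norm (B - A h) < d \<longrightarrow> P B"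
    unfolding P_def by (rule spectral_function_first_order[OF W pos v \<Gamma> f c \<open>e / C > 0\<close>])
  then obtain d where d: "d > 0" "\<And>B. hermitian_mat B \<Longrightarrow> norm (B - A h) < d \<Longrightarrow> P B"
    by blast
  have "norm (G k - G h - (\<Sum>a\<in>UNIV. partial_deriv f a (\<chi> i. \<mu> i) * Re (sesq (A' (k - h)) (v a) (v a)))) \<le> e * norm (k - h)"
    if k: "k \<in> S" "norm (k - h) < d / C" for k
  proof -
    have K: "A k - A h = A' (k - h)" using A(1)[of k] by simp
    have "norm (A k - A h) \<le> norm (k - h) * C" unfolding K by (rule C(2))
    also have "\<dots> < d" using k(2) C(1) by (simp add: pos_less_divide_eq)
    finally obtain u l where u: "pencil_diag W (A k) u l" "(\<chi> a. l a) \<in> \<Gamma>"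
      "\<bar>f (\<chi> a. l a) - f (\<chi> a. \<mu> a) - (\<Sum>a\<in>UNIV. partial_deriv f a (\<chi> i. \<mu> i) * Re (sesq (A k - A h) (v a) (v a)))\<bar>
        \<le> e / C * norm (A k - A h)"
      using d(2)[OF herm[OF k(1)]] unfolding P_def by auto
    have "e / C * norm (A k - A h) \<le> e / C * (norm (k - h) * C)"
      unfolding K using C e by (intro mult_left_mono) auto
    also have "\<dots> = e * norm (k - h)" using C by simp
    finally show ?thesis
      using u(3) G[OF k(1) u(1,2)] G[OF h v \<Gamma>(2)] by (simp add: K)
  qed
  then show "\<exists>d>0. \<forall>k\<in>S. norm (k - h) < d \<longrightarrow>
      norm (G k - G h - (\<Sum>a\<in>UNIV. partial_deriv f a (\<chi> i. \<mu> i) * Re (sesq (A' (k - h)) (v a) (v a)))) \<le> e * norm (k - h)"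
    using d(1) C(1) by (intro exI[of _ "d / C"]) auto
qed

lemma partial_deriv_symmetric:
  fixes f :: "real^'k::finite \<Rightarrow> real"
  assumes \<Gamma>: "open \<Gamma>" "x \<in> \<Gamma>" and f: "f differentiable (at x)"
    and sym: "symmetric_function_on \<Gamma> f" and ab: "x $ a = x $ b"
  shows "partial_deriv f a x = partial_deriv f b x"
proof -
  define \<tau> where "\<tau> = Transposition.transpose a b"
  define P where "P = (\<lambda>y :: real^'k. \<chi> i. y $ \<tau> i)"
  let ?D = "frechet_derivative f (at x)"
  have D: "(f has_derivative ?D) (at x)" using f frechet_derivative_works by blast
  have P_lin: "bounded_linear P"
    unfolding linear_conv_bounded_linear[symmetric]
    by (intro linearI) (simp_all add: P_def Finite_Cartesian_Product.vec_eq_iff)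
  have Px: "P x = x"
    using ab by (auto simp: P_def \<tau>_def Finite_Cartesian_Product.vec_eq_iff Transposition.transpose_def)
  have "((\<lambda>y. f (P y)) has_derivative (\<lambda>y. ?D (P y))) (at x)"
    using has_derivative_compose[OF bounded_linear_imp_has_derivative[OF P_lin, of "at x"], of f ?D] D
    by (simp add: Px)
  then have "(f has_derivative (\<lambda>y. ?D (P y))) (at x)"
  proof (rule has_derivative_transform_within_open[OF _ \<Gamma>])
    fix y assume "y \<in> \<Gamma>"
    then show "f (P y) = f y"
      using sym by (simp add: symmetric_function_on_def P_def \<tau>_def)
  qed
  then have "?D = (\<lambda>y. ?D (P y))" by (rule has_derivative_unique[OF D])
  then have "?D (axis a 1) = ?D (P (axis a 1))" by metis
  also have "P (axis a 1) = axis b 1"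
    by (auto simp: P_def \<tau>_def Finite_Cartesian_Product.vec_eq_iff Transposition.transpose_def axis_def)
  finally show ?thesis by (simp add: partial_deriv_def)
qed

section \<open>Eigenvalues of a form as roots of a pencil\<close>

lemma mat_mult_mat:
  "Matrix.mat n n f * Matrix.mat n n g =
     Matrix.mat n n (\<lambda>(i, j). \<Sum>k = 0..<n. f (i, k) * (g (k, j) :: 'a :: semiring_0))"
  by (rule eq_matI) (auto simp: scalar_prod_def)

lemma det_diagonal_mat:
  "Determinant.det (Matrix.mat n n (\<lambda>(i, j). if i = j then d i else 0)) = (\<Prod>i = 0..<n. d i)"
proof -
  have "Determinant.det (Matrix.mat n n (\<lambda>(i, j). if i = j then d i else 0))
      = prod_list (diag_mat (Matrix.mat n n (\<lambda>(i, j). if i = j then d i else 0)))"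
    by (rule det_upper_triangular[of _ n]) auto
  also have "\<dots> = (\<Prod>i = 0..<n. d i)"
    by (simp add: prod_list_diag_prod)
  finally show ?thesis .
qed

text \<open>The enumeration \<open>e\<close> translates between matrices indexed by a finite type and by an interval of
  natural numbers.\<close>

lemma det_congruence:
  fixes C :: "'k::finite cmat" and u :: "'k \<Rightarrow> complex^'k"
  assumes e: "bij_betw e {0..<n} (UNIV :: 'k set)"
  shows "Determinant.det (Matrix.mat n n (\<lambda>(i, j). sesq C (u (e i)) (u (e j)))) =
    Determinant.det (Matrix.mat n n (\<lambda>(i, j). u (e i) $ e j)) *
    Determinant.det (Matrix.mat n n (\<lambda>(i, j). C $ e i $ e j)) *
    Determinant.det (Matrix.mat n n (\<lambda>(i, j). cnj (u (e j) $ e i)))"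
proof -
  have "Matrix.mat n n (\<lambda>(i, j). sesq C (u (e i)) (u (e j))) =
    Matrix.mat n n (\<lambda>(i, j). u (e i) $ e j) * Matrix.mat n n (\<lambda>(i, j). C $ e i $ e j) *
    Matrix.mat n n (\<lambda>(i, j). cnj (u (e j) $ e i))"
  proof -
    have "sesq C x y = (\<Sum>k = 0..<n. (\<Sum>i = 0..<n. x $ e i * C $ e i $ e k) * cnj (y $ e k))" for x y
    proof -
      have "sesq C x y = (\<Sum>k\<in>UNIV. (\<Sum>i\<in>UNIV. x $ i * C $ i $ k) * cnj (y $ k))"
        unfolding sesq_def by (subst sum.swap) (simp add: sum_distrib_left sum_distrib_right mult_ac)
      then show ?thesis by (simp only: sum.reindex_bij_betw[OF e, symmetric])
    qed
    then show ?thesis by (simp add: mat_mult_mat case_prod_unfold)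
  qed
  then show ?thesis
    by (simp only: Determinant.det_mult[OF mult_carrier_mat[OF mat_carrier mat_carrier] mat_carrier]
        Determinant.det_mult[OF mat_carrier mat_carrier])
qed

lemma poly_det_pencil:
  fixes B W :: "'k::finite cmat"
  assumes e: "bij_betw e {0..<n} (UNIV :: 'k set)" and u: "pencil_diag W B u l"
  obtains c where "c \<noteq> 0"
    "Determinant.det (Matrix.mat n n (\<lambda>(i, j). [: B $ e i $ e j, - W $ e i $ e j :])) =
      Polynomial.smult c (\<Prod>a\<in>UNIV. [: - of_real (l a), 1 :])"
proof -
  define P where "P = Matrix.mat n n (\<lambda>(i, j). [: B $ e i $ e j, - W $ e i $ e j :])"
  define U where "U = Determinant.det (Matrix.mat n n (\<lambda>(i, j). u (e i) $ e j))"
  define U' where "U' = Determinant.det (Matrix.mat n n (\<lambda>(i, j). cnj (u (e j) $ e i)))"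
  define w where "w = Determinant.det (Matrix.mat n n (\<lambda>(i, j). W $ e i $ e j))"
  have inj: "i < n \<Longrightarrow> j < n \<Longrightarrow> e i = e j \<longleftrightarrow> i = j" for i j
    using e by (auto simp: bij_betw_def inj_on_def)
  have "U * w * U' = Determinant.det (Matrix.mat n n (\<lambda>(i, j). sesq W (u (e i)) (u (e j))))"
    unfolding U_def U'_def w_def by (rule det_congruence[OF e, symmetric])
  also have "Matrix.mat n n (\<lambda>(i, j). sesq W (u (e i)) (u (e j))) =
      Matrix.mat n n (\<lambda>(i, j). if i = j then 1 else 0)"
    by (rule eq_matI) (auto simp: pencil_diagD(1)[OF u] inj)
  finally have UwU: "U * w * U' = 1" by (simp add: det_diagonal_mat)
  have "poly (Determinant.det P) x = poly (Polynomial.smult (w * (-1) ^ n) (\<Prod>a\<in>UNIV. [: - of_real (l a), 1 :])) x" for x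
  proof -
    \<comment> \<open>The eigenbasis diagonalises the pencil at every complex \<open>x\<close>.\<close>
    define C where "C = (\<chi> i j. B $ i $ j - x * W $ i $ j)"
    interpret hom: comm_ring_hom "\<lambda>q. poly q x" by unfold_locales auto
    have C: "sesq C y z = sesq B y z - x * sesq W y z" for y z
      by (simp add: C_def sesq_def left_diff_distrib sum_subtractf sum_distrib_left mult.assoc)
    have "poly (Determinant.det P) x = Determinant.det (Matrix.mat n n (\<lambda>(i, j). C $ e i $ e j))"
      unfolding hom.hom_det[symmetric] P_def
      by (intro arg_cong[where f = Determinant.det] eq_matI) (auto simp: C_def)
    moreover have "U * Determinant.det (Matrix.mat n n (\<lambda>(i, j). C $ e i $ e j)) * U' =
        (\<Prod>a\<in>UNIV. of_real (l a) - x)"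
    proof -
      have "U * Determinant.det (Matrix.mat n n (\<lambda>(i, j). C $ e i $ e j)) * U' =
          Determinant.det (Matrix.mat n n (\<lambda>(i, j). sesq C (u (e i)) (u (e j))))"
        unfolding U_def U'_def by (rule det_congruence[OF e, symmetric])
      also have "Matrix.mat n n (\<lambda>(i, j). sesq C (u (e i)) (u (e j))) =
          Matrix.mat n n (\<lambda>(i, j). if i = j then of_real (l (e i)) - x else 0)"
        by (rule eq_matI) (auto simp: C pencil_diagD[OF u] inj)
      also have "Determinant.det \<dots> = (\<Prod>i = 0..<n. of_real (l (e i)) - x)"
        by (rule det_diagonal_mat)
      also have "\<dots> = (\<Prod>a\<in>UNIV. of_real (l a) - x)"
        by (rule prod.reindex_bij_betw[OF e])
      finally show ?thesis .
    qed
    moreover have "(\<Prod>a\<in>UNIV. of_real (l a) - x) = (-1) ^ n * (\<Prod>a\<in>UNIV. x - of_real (l a))"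
    proof -
      have "(\<Prod>a\<in>UNIV. of_real (l a) - x) = (\<Prod>a\<in>UNIV. (-1) * (x - of_real (l a)))"
        by (intro prod.cong) auto
      also have "\<dots> = (-1) ^ CARD('k) * (\<Prod>a\<in>UNIV. x - of_real (l a))"
        by (simp only: prod.distrib prod_constant)
      finally show ?thesis using bij_betw_same_card[OF e] by simp
    qed
    ultimately have "U * poly (Determinant.det P) x * U' = (-1) ^ n * (\<Prod>a\<in>UNIV. x - of_real (l a))"
      by simp
    then have "(U * w * U') * poly (Determinant.det P) x = w * (-1) ^ n * (\<Prod>a\<in>UNIV. x - of_real (l a))"
      by (simp add: mult_ac)
    then show ?thesis by (simp add: UwU poly_prod)
  qed
  then have "Determinant.det P = Polynomial.smult (w * (-1) ^ n) (\<Prod>a\<in>UNIV. [: - of_real (l a), 1 :])"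
    using poly_eq_poly_eq_iff by blast
  moreover have "w * (-1) ^ n \<noteq> 0" using UwU by auto
  ultimately show thesis unfolding P_def by (intro that)
qed

lemma proots_prod_linear:
  fixes r :: "'k::finite \<Rightarrow> complex"
  assumes "c \<noteq> 0"
  shows "proots (Polynomial.smult c (\<Prod>a\<in>UNIV. [: - r a, 1 :])) = image_mset r (mset_set UNIV)"
proof -
  have "proots (Polynomial.smult c (\<Prod>a\<in>UNIV. [: - r a, 1 :])) = proots (\<Prod>a\<in>UNIV. [: - r a, 1 :])"
    by (rule Polynomial.proots_smult[OF assms])
  also have "\<dots> = (\<Sum>a\<in>UNIV. proots [: - r a, 1 :])"
    by (rule Polynomial.proots_prod) auto
  also have "\<dots> = (\<Sum>a\<in>UNIV. {#r a#})" by simp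
  also have "\<dots> = image_mset r (mset_set UNIV)"
    by (simp add: sum_unfold_sum_mset)
  finally show ?thesis .
qed

text \<open>The increasing multi-index with the number \<open>a\<close>, where the enumeration \<open>e\<close> of the index type of the
  eigenvalues identifies it with the positions in the list of multi-indices.\<close>

definition multi_index :: "nat \<Rightarrow> (nat \<Rightarrow> 'k::finite) \<Rightarrow> 'k \<Rightarrow> 'n::{finite,linorder} list" where
  "multi_index p e a = multi_indices p ! inv_into {0..<CARD('k)} e a"

text \<open>The matrix of a family \<open>c\<close> of coefficients, indexed by the index type of the eigenvalues.\<close>

definition index_mat ::
  "nat \<Rightarrow> (nat \<Rightarrow> 'k) \<Rightarrow> ('n::{finite,linorder} list \<Rightarrow> 'n list \<Rightarrow> complex) \<Rightarrow> 'k::finite cmat" where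
  "index_mat p e c = (\<chi> a b. c (multi_index p e a) (multi_index p e b))"

lemma eigenvalues_pencil_diag:
  fixes \<omega> \<Omega> :: "'n::{finite,linorder} form" and e :: "nat \<Rightarrow> 'k::finite"
  assumes e: "bij_betw e {0..<CARD('k)} (UNIV :: 'k set)"
    and len: "length (multi_indices p :: 'n list list) = CARD('k)"
    and u: "pencil_diag (index_mat p e (metric_minor p \<omega>)) (index_mat p e (pp_coeff p \<Omega>)) u l"
  shows "\<exists>\<pi> :: 'k \<Rightarrow> 'k. bij \<pi> \<and> eigenvalues p \<omega> \<Omega> = (\<chi> a. l (\<pi> a))"
proof -
  have inv: "inv_into {0..<CARD('k)} e (e i) = i" if "i < CARD('k)" for i
    using e that by (auto simp: bij_betw_def)
  have "eigen_poly p \<omega> \<Omega> = Determinant.det (Matrix.mat (CARD('k)) (CARD('k)) (\<lambda>(i, j).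
      [: index_mat p e (pp_coeff p \<Omega>) $ e i $ e j, - index_mat p e (metric_minor p \<omega>) $ e i $ e j :]))"
    unfolding eigen_poly_def Let_def len
    by (intro arg_cong[where f = Determinant.det] eq_matI) (auto simp: index_mat_def multi_index_def inv)
  then obtain c where "c \<noteq> 0" "eigen_poly p \<omega> \<Omega> = Polynomial.smult c (\<Prod>a\<in>UNIV. [: - of_real (l a), 1 :])"
    using poly_det_pencil[OF e u] by metis
  then have "proots (eigen_poly p \<omega> \<Omega>) = image_mset (\<lambda>a. of_real (l a)) (mset_set UNIV)"
    using proots_prod_linear[of c "\<lambda>a. of_real (l a)"] by simp
  then have ex: "image_mset (\<lambda>i. complex_of_real ((\<chi> a. l a) $ i)) (mset_set UNIV) = proots (eigen_poly p \<omega> \<Omega>)"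
    by simp
  have "image_mset (\<lambda>i. complex_of_real ((eigenvalues p \<omega> \<Omega> :: real^'k) $ i)) (mset_set UNIV) = proots (eigen_poly p \<omega> \<Omega>)"
  proof -
    have "\<exists>l :: real^'k. image_mset (\<lambda>i. complex_of_real (l $ i)) (mset_set UNIV) =
        proots (eigen_poly p \<omega> \<Omega>)"
      using ex by blast
    from someI_ex[OF this] show ?thesis unfolding eigenvalues_def .
  qed
  with ex have eq: "image_mset (\<lambda>i. complex_of_real ((eigenvalues p \<omega> \<Omega> :: real^'k) $ i)) (mset_set UNIV) =
      image_mset (\<lambda>i. complex_of_real (l i)) (mset_set (UNIV :: 'k set))"
    by simp
  obtain \<pi> where "\<pi> permutes (UNIV :: 'k set)" "\<forall>a\<in>UNIV. complex_of_real ((eigenvalues p \<omega> \<Omega> :: real^'k) $ a) = complex_of_real (l (\<pi> a))"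
    by (rule image_mset_eq_implies_permutes[OF finite eq])
  then show ?thesis
    by (intro exI[of _ \<pi>]) (auto simp: Finite_Cartesian_Product.vec_eq_iff permutes_bij)
qed

lemma bij_betw_set_increasing_lists:
  "bij_betw set {I :: 'n::{finite,linorder} list. length I = p \<and> sorted_wrt (<) I} {S. card S = p}"
proof (rule bij_betw_imageI)
  show "inj_on set {I :: 'n list. length I = p \<and> sorted_wrt (<) I}"
    by (auto simp: inj_on_def intro: strict_sorted_equal)
  show "set ` {I :: 'n list. length I = p \<and> sorted_wrt (<) I} = {S. card S = p}"
  proof (intro equalityI subsetI)
    fix S :: "'n set" assume "S \<in> {S. card S = p}"
    then show "S \<in> set ` {I. length I = p \<and> sorted_wrt (<) I}"
      by (intro image_eqI[of _ _ "sorted_list_of_set S"]) auto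
  qed (auto simp: strict_sorted_iff distinct_card)
qed

lemma length_multi_indices:
  "length (multi_indices p :: 'n::{finite,linorder} list list) = CARD('n) choose p"
  and set_multi_indices:
  "set (multi_indices p :: 'n list list) = {I. length I = p \<and> sorted_wrt (<) I}"
proof -
  let ?L = "{I :: 'n list. length I = p \<and> sorted_wrt (<) I}"
  have "bij_betw set ?L {S :: 'n set. S \<subseteq> UNIV \<and> card S = p}"
    using bij_betw_set_increasing_lists by simp
  then have card: "card ?L = CARD('n) choose p"
    using bij_betw_same_card n_subsets[of "UNIV :: 'n set" p] by fastforce
  have fin: "finite ?L"
    by (rule finite_subset[OF _ finite_lists_length_eq[of "UNIV :: 'n set" p]]) auto
  show "length (multi_indices p :: 'n list list) = CARD('n) choose p"
    unfolding multi_indices_def using card by simp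
  show "set (multi_indices p :: 'n list list) = ?L"
    unfolding multi_indices_def using fin by simp
qed

lemma distinct_multi_indices: "distinct (multi_indices p :: 'n::{finite,linorder} list list)"
  unfolding multi_indices_def by simp

lemma bij_betw_multi_index:
  fixes e :: "nat \<Rightarrow> 'k::finite"
  assumes e: "bij_betw e {0..<CARD('k)} (UNIV :: 'k set)"
    and len: "length (multi_indices p :: 'n::{finite,linorder} list list) = CARD('k)"
  shows "bij_betw (multi_index p e) UNIV
    {I :: 'n list. length I = p \<and> sorted_wrt (<) I}"
proof -
  have "bij_betw ((!) (multi_indices p :: 'n list list)) {0..<CARD('k)} (set (multi_indices p))"
    using len distinct_multi_indices by (intro bij_betw_nth) auto
  then show ?thesis
    using bij_betw_trans[OF bij_betw_inv_into[OF e]] by (auto simp: set_multi_indices comp_def multi_index_def[abs_def])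
qed

section \<open>Positivity of the compound of the metric\<close>

lemma prod_sum_tuples:
  fixes g :: "nat \<Rightarrow> 'n::finite \<Rightarrow> complex"
  shows "(\<Prod>k = 0..<p. \<Sum>s\<in>UNIV. g k s) = (\<Sum>\<kappa>\<in>{0..<p} \<rightarrow>\<^sub>E UNIV. \<Prod>k = 0..<p. g k (\<kappa> k))"
  by (rule prod_sum_PiE) auto

text \<open>Multilinearity of the determinant in the rows.\<close>

lemma det_rows_sum:
  fixes a b :: "nat \<Rightarrow> 'n::finite \<Rightarrow> complex"
  shows "Determinant.det (Matrix.mat p p (\<lambda>(k, l). \<Sum>s\<in>UNIV. a k s * b l s)) =
    (\<Sum>\<kappa>\<in>{0..<p} \<rightarrow>\<^sub>E UNIV. (\<Prod>k = 0..<p. a k (\<kappa> k)) *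
        Determinant.det (Matrix.mat p p (\<lambda>(k, l). b l (\<kappa> k))))"
proof -
  have lt: "\<sigma> i < p" if "\<sigma> permutes {0..<p}" "i < p" for \<sigma> i
    using permutes_in_image[OF that(1), of i] that(2) by simp
  have "Determinant.det (Matrix.mat p p (\<lambda>(k, l). \<Sum>s\<in>UNIV. a k s * b l s)) =
      (\<Sum>\<sigma> | \<sigma> permutes {0..<p}. signof \<sigma> * (\<Prod>k = 0..<p. \<Sum>s\<in>UNIV. a k s * b (\<sigma> k) s))"
    by (subst Determinant.det_def'[OF mat_carrier]) (auto intro!: sum.cong prod.cong simp: lt)
  also have "\<dots> = (\<Sum>\<sigma> | \<sigma> permutes {0..<p}. \<Sum>\<kappa>\<in>{0..<p} \<rightarrow>\<^sub>E UNIV.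
      (\<Prod>k = 0..<p. a k (\<kappa> k)) * (signof \<sigma> * (\<Prod>k = 0..<p. b (\<sigma> k) (\<kappa> k))))"
    by (simp add: prod_sum_tuples sum_distrib_left prod.distrib mult_ac)
  also have "\<dots> = (\<Sum>\<kappa>\<in>{0..<p} \<rightarrow>\<^sub>E UNIV. (\<Prod>k = 0..<p. a k (\<kappa> k)) *
      (\<Sum>\<sigma> | \<sigma> permutes {0..<p}. signof \<sigma> * (\<Prod>k = 0..<p. b (\<sigma> k) (\<kappa> k))))"
    by (subst sum.swap) (simp add: sum_distrib_left)
  also have "\<dots> = (\<Sum>\<kappa>\<in>{0..<p} \<rightarrow>\<^sub>E UNIV. (\<Prod>k = 0..<p. a k (\<kappa> k)) *
        Determinant.det (Matrix.mat p p (\<lambda>(k, l). b l (\<kappa> k))))"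
    by (intro sum.cong refl arg_cong2[where f = "(*)"], subst Determinant.det_def'[OF mat_carrier])
      (auto intro!: sum.cong prod.cong simp: lt)
  finally show ?thesis .
qed

text \<open>The Cauchy--Binet formula, summed over all tuples instead of the increasing ones.\<close>

lemma det_gram_tuples:
  fixes a b :: "nat \<Rightarrow> 'n::finite \<Rightarrow> complex"
  shows "fact p * Determinant.det (Matrix.mat p p (\<lambda>(k, l). \<Sum>s\<in>UNIV. a k s * b l s)) =
    (\<Sum>\<kappa>\<in>{0..<p} \<rightarrow>\<^sub>E UNIV. Determinant.det (Matrix.mat p p (\<lambda>(k, l). a k (\<kappa> l))) *
        Determinant.det (Matrix.mat p p (\<lambda>(k, l). b k (\<kappa> l))))"
proof -
  let ?E = "{0..<p} \<rightarrow>\<^sub>E (UNIV :: 'n set)"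
  let ?G = "Determinant.det (Matrix.mat p p (\<lambda>(k, l). \<Sum>s\<in>UNIV. a k s * b l s))"
  let ?D = "\<lambda>\<kappa>. Determinant.det (Matrix.mat p p (\<lambda>(k, l). b l (\<kappa> k)))"
  let ?P = "{\<tau>. \<tau> permutes {0..<p}}"
  have lt: "\<sigma> i < p" if "\<sigma> permutes {0..<p}" "i < p" for \<sigma> i
    using permutes_in_image[OF that(1), of i] that(2) by simp
  \<comment> \<open>Reindexing the tuples by \<open>\<tau>\<close> costs the sign of \<open>\<tau>\<close>; averaging over \<open>\<tau>\<close> restores the symmetry
    between \<open>a\<close> and \<open>b\<close>.\<close>
  have perm: "?G = (\<Sum>\<kappa>\<in>?E. signof \<tau> * (\<Prod>k = 0..<p. a k (\<kappa> (\<tau> k))) * ?D \<kappa>)" if \<tau>: "\<tau> \<in> ?P" for \<tau>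
  proof -
    have \<tau>': "\<tau> permutes {0..<p}" using \<tau> by simp
    have bij: "bij_betw (\<lambda>\<kappa>. restrict (\<kappa> \<circ> \<tau>) {0..<p}) ?E ?E"
    proof (rule bij_betw_byWitness[where f' = "\<lambda>\<kappa>. restrict (\<kappa> \<circ> Hilbert_Choice.inv \<tau>) {0..<p}"])
      show "\<forall>\<kappa>\<in>?E. restrict (restrict (\<kappa> \<circ> \<tau>) {0..<p} \<circ> Hilbert_Choice.inv \<tau>) {0..<p} = \<kappa>"
        using lt[OF permutes_inv[OF \<tau>']] permutes_inverses[OF \<tau>']
        by (auto simp: fun_eq_iff restrict_def PiE_def extensional_def)
      show "\<forall>\<kappa>\<in>?E. restrict (restrict (\<kappa> \<circ> Hilbert_Choice.inv \<tau>) {0..<p} \<circ> \<tau>) {0..<p} = \<kappa>"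
        using lt[OF \<tau>'] permutes_inverses[OF \<tau>']
        by (auto simp: fun_eq_iff restrict_def PiE_def extensional_def)
    qed auto
    have "?G = (\<Sum>\<kappa>\<in>?E. (\<Prod>k = 0..<p. a k (\<kappa> k)) * ?D \<kappa>)" by (rule det_rows_sum)
    also have "\<dots> = (\<Sum>\<kappa>\<in>?E. (\<Prod>k = 0..<p. a k (restrict (\<kappa> \<circ> \<tau>) {0..<p} k)) *
        ?D (restrict (\<kappa> \<circ> \<tau>) {0..<p}))"
      by (rule sum.reindex_bij_betw[OF bij, symmetric])
    also have "\<dots> = (\<Sum>\<kappa>\<in>?E. signof \<tau> * (\<Prod>k = 0..<p. a k (\<kappa> (\<tau> k))) * ?D \<kappa>)"
    proof (intro sum.cong refl)
      fix \<kappa>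
      have "Determinant.det (Matrix.mat p p (\<lambda>(k, l). b l (restrict (\<kappa> \<circ> \<tau>) {0..<p} k))) =
          Determinant.det (Matrix.mat p p (\<lambda>(i, j). Matrix.mat p p (\<lambda>(k, l). b l (\<kappa> k)) $$ (\<tau> i, j)))"
        by (intro arg_cong[where f = Determinant.det] eq_matI) (auto simp: lt[OF \<tau>'])
      also have "\<dots> = signof \<tau> * ?D \<kappa>"
        by (rule det_permute_rows[OF mat_carrier \<tau>'])
      finally show "(\<Prod>k = 0..<p. a k (restrict (\<kappa> \<circ> \<tau>) {0..<p} k)) * ?D (restrict (\<kappa> \<circ> \<tau>) {0..<p}) =
          signof \<tau> * (\<Prod>k = 0..<p. a k (\<kappa> (\<tau> k))) * ?D \<kappa>"
        by simp
    qed
    finally show ?thesis .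
  qed
  have "fact p * ?G = (\<Sum>\<tau>\<in>?P. ?G)"
    by (simp add: card_permutations[of "{0..<p}" p])
  also have "\<dots> = (\<Sum>\<tau>\<in>?P. \<Sum>\<kappa>\<in>?E. signof \<tau> * (\<Prod>k = 0..<p. a k (\<kappa> (\<tau> k))) * ?D \<kappa>)"
    by (intro sum.cong refl perm)
  also have "\<dots> = (\<Sum>\<kappa>\<in>?E. (\<Sum>\<tau>\<in>?P. signof \<tau> * (\<Prod>k = 0..<p. a k (\<kappa> (\<tau> k)))) * ?D \<kappa>)"
    by (subst sum.swap) (simp add: sum_distrib_right)
  also have "\<dots> = (\<Sum>\<kappa>\<in>?E. Determinant.det (Matrix.mat p p (\<lambda>(k, l). a k (\<kappa> l))) *
        Determinant.det (Matrix.mat p p (\<lambda>(k, l). b k (\<kappa> l))))"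
  proof (intro sum.cong refl arg_cong2[where f = "(*)"])
    fix \<kappa>
    show "(\<Sum>\<tau>\<in>?P. signof \<tau> * (\<Prod>k = 0..<p. a k (\<kappa> (\<tau> k)))) =
        Determinant.det (Matrix.mat p p (\<lambda>(k, l). a k (\<kappa> l)))"
      by (subst Determinant.det_def'[OF mat_carrier]) (auto intro!: sum.cong prod.cong simp: lt)
    have "?D \<kappa> = Determinant.det (Matrix.transpose_mat (Matrix.mat p p (\<lambda>(k, l). b k (\<kappa> l))))"
      by (intro arg_cong[where f = Determinant.det] eq_matI) auto
    then show "?D \<kappa> = Determinant.det (Matrix.mat p p (\<lambda>(k, l). b k (\<kappa> l)))"
      by (simp add: Determinant.det_transpose[OF mat_carrier])
  qed
  finally show ?thesis .
qed

lemma cnj_det_mat: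
  "cnj (Determinant.det (Matrix.mat p p f)) = Determinant.det (Matrix.mat p p (\<lambda>x. cnj (f x)))"
proof -
  interpret comm_ring_hom cnj by unfold_locales auto
  have "Matrix.mat p p (\<lambda>x. cnj (f x)) = map_mat cnj (Matrix.mat p p f)" by (rule eq_matI) auto
  then show ?thesis by (simp only: hom_det)
qed

lemma metric_minor_hermitian:
  assumes g: "\<And>i j. metric_coeff \<omega> j i = cnj (metric_coeff \<omega> i j)"
  shows "metric_minor p \<omega> J I = cnj (metric_minor p \<omega> I J)"
proof -
  have "cnj (metric_minor p \<omega> I J) =
      Determinant.det (Matrix.transpose_mat (Matrix.mat p p (\<lambda>(k, l). metric_coeff \<omega> (J ! k) (I ! l))))"
    unfolding metric_minor_def cnj_det_mat
    by (intro arg_cong[where f = Determinant.det] eq_matI) (auto simp: g[symmetric])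
  then show ?thesis by (simp add: metric_minor_def Determinant.det_transpose[OF mat_carrier])
qed

lemma det_increasing_delta:
  fixes I J :: "'n::linorder list"
  assumes "length I = p" "length J = p" "sorted_wrt (<) I" "sorted_wrt (<) J"
  shows "Determinant.det (Matrix.mat p p (\<lambda>(k, l). if I ! k = J ! l then 1 else 0)) =
    (if I = J then 1 else (0 :: complex))"
proof (cases "I = J")
  case True
  have "distinct J" using assms strict_sorted_iff by blast
  then have "Matrix.mat p p (\<lambda>(k, l). if I ! k = J ! l then 1 else 0) = (1\<^sub>m p :: complex mat)"
    using True assms by (intro eq_matI) (auto simp: nth_eq_iff_index_eq)
  then show ?thesis using True by simp
next
  case False
  have "\<not> set I \<subseteq> set J"
  proof
    assume "set I \<subseteq> set J"
    moreover have "card (set I) = card (set J)"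
      using assms by (auto simp: strict_sorted_iff distinct_card)
    ultimately have "set I = set J" by (simp add: card_subset_eq)
    then show False using assms False strict_sorted_equal by blast
  qed
  then obtain k where k: "k < p" "I ! k \<notin> set J"
    using assms by (metis in_set_conv_nth subsetI)
  let ?A = "Matrix.mat p p (\<lambda>(k, l). if I ! k = J ! l then 1 else (0 :: complex))"
  have "(\<Prod>i = 0..<p. ?A $$ (i, \<sigma> i)) = 0" if "\<sigma> permutes {0..<p}" for \<sigma>
  proof (rule prod_zero)
    have "\<sigma> k < p" using permutes_in_image[OF that, of k] k by simp
    then show "\<exists>i\<in>{0..<p}. ?A $$ (i, \<sigma> i) = 0"
      using k assms by (intro bexI[of _ k]) auto
  qed simp
  then have "Determinant.det ?A = 0"
    unfolding Determinant.det_def'[OF mat_carrier]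
    by (intro sum.neutral ballI) (simp only: mult_zero_right mem_Collect_eq)
  then show ?thesis using False by simp
qed

text \<open>The matrix of minors of a positive definite matrix \<open>a a\<^sup>*\<close> is positive definite; \<open>c\<close> is the inverse
  of \<open>a\<close>.\<close>

lemma metric_minor_pos_def:
  fixes p :: nat and \<omega> :: "'n::{finite,linorder} form" and a c :: "'n \<Rightarrow> 'n \<Rightarrow> complex" and \<xi> :: "'n list \<Rightarrow> complex"
  defines "S \<equiv> {I :: 'n list. length I = p \<and> sorted_wrt (<) I}"
  assumes g: "\<And>i j. metric_coeff \<omega> i j = (\<Sum>s\<in>UNIV. a i s * cnj (a j s))"
    and ac: "\<And>i j. (\<Sum>s\<in>UNIV. a i s * c s j) = (if i = j then 1 else 0)"
    and \<xi>: "K \<in> S" "\<xi> K \<noteq> 0"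
  shows "Re (\<Sum>I\<in>S. \<Sum>J\<in>S. metric_minor p \<omega> I J * \<xi> I * cnj (\<xi> J)) > 0"
proof -
  let ?E = "{0..<p} \<rightarrow>\<^sub>E (UNIV :: 'n set)"
  define D where "D = (\<lambda>I \<kappa>. Determinant.det (Matrix.mat p p (\<lambda>(k, l). a (I ! k) (\<kappa> l))))"
  define T where "T = (\<lambda>\<kappa>. \<Sum>I\<in>S. \<xi> I * D I \<kappa>)"
  have minor: "fact p * metric_minor p \<omega> I J = (\<Sum>\<kappa>\<in>?E. D I \<kappa> * cnj (D J \<kappa>))" for I J
  proof -
    have "cnj (D J \<kappa>) = Determinant.det (Matrix.mat p p (\<lambda>(k, l). cnj (a (J ! k) (\<kappa> l))))" for \<kappa>
      unfolding D_def cnj_det_mat by (simp add: case_prod_unfold)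
    then show ?thesis
      unfolding metric_minor_def g D_def
      using det_gram_tuples[of p "\<lambda>k. a (I ! k)" "\<lambda>k s. cnj (a (J ! k) s)"] by simp
  qed
  have "fact p * (\<Sum>I\<in>S. \<Sum>J\<in>S. metric_minor p \<omega> I J * \<xi> I * cnj (\<xi> J)) =
      (\<Sum>I\<in>S. \<Sum>J\<in>S. (fact p * metric_minor p \<omega> I J) * \<xi> I * cnj (\<xi> J))"
    by (simp add: sum_distrib_left mult.assoc)
  also have "\<dots> = (\<Sum>I\<in>S. \<Sum>J\<in>S. \<Sum>\<kappa>\<in>?E. (\<xi> I * D I \<kappa>) * cnj (\<xi> J * D J \<kappa>))"
    unfolding minor by (simp add: sum_distrib_left sum_distrib_right mult_ac)
  also have "\<dots> = (\<Sum>I\<in>S. \<Sum>\<kappa>\<in>?E. \<Sum>J\<in>S. (\<xi> I * D I \<kappa>) * cnj (\<xi> J * D J \<kappa>))"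
    by (intro sum.cong refl sum.swap)
  also have "\<dots> = (\<Sum>\<kappa>\<in>?E. \<Sum>I\<in>S. \<Sum>J\<in>S. (\<xi> I * D I \<kappa>) * cnj (\<xi> J * D J \<kappa>))"
    by (rule sum.swap)
  also have "\<dots> = (\<Sum>\<kappa>\<in>?E. T \<kappa> * cnj (T \<kappa>))"
    unfolding T_def cnj_sum sum_product ..
  also have "\<dots> = of_real (\<Sum>\<kappa>\<in>?E. (cmod (T \<kappa>))\<^sup>2)"
    unfolding of_real_sum complex_norm_square ..
  finally have "Re (fact p * (\<Sum>I\<in>S. \<Sum>J\<in>S. metric_minor p \<omega> I J * \<xi> I * cnj (\<xi> J))) =
      (\<Sum>\<kappa>\<in>?E. (cmod (T \<kappa>))\<^sup>2)"
    by simp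
  also have "fact p = complex_of_real (fact p)" by simp
  finally have eq: "fact p * Re (\<Sum>I\<in>S. \<Sum>J\<in>S. metric_minor p \<omega> I J * \<xi> I * cnj (\<xi> J)) =
      (\<Sum>\<kappa>\<in>?E. (cmod (T \<kappa>))\<^sup>2)"
    by (simp only: times_complex.sel Re_complex_of_real Im_complex_of_real mult_zero_left diff_zero)
  have "\<exists>\<kappa>\<in>?E. T \<kappa> \<noteq> 0"
  proof (rule ccontr)
    assume "\<not> ?thesis"
    then have T0: "T \<kappa> = 0" if "\<kappa> \<in> ?E" for \<kappa> using that by blast
    \<comment> \<open>Multiplying \<open>a\<close> by its inverse recovers the minors of the identity matrix from those of \<open>a\<close>.\<close>
    have delta: "(if I = K then 1 else 0) = (\<Sum>\<kappa>\<in>?E. (\<Prod>l = 0..<p. c (\<kappa> l) (K ! l)) * D I \<kappa>)"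
      if I: "I \<in> S" for I
    proof -
      have "(if I = K then 1 else 0) =
          Determinant.det (Matrix.mat p p (\<lambda>(k, l). if K ! k = I ! l then 1 else (0 :: complex)))"
        using det_increasing_delta[of K p I] I \<xi>(1) by (auto simp: S_def)
      also have "\<dots> = Determinant.det (Matrix.mat p p (\<lambda>(k, l). \<Sum>s\<in>UNIV. c s (K ! k) * a (I ! l) s))"
        by (intro arg_cong[where f = Determinant.det] eq_matI)
          (auto simp: ac mult.commute[of "c _ _"])
      also have "\<dots> = (\<Sum>\<kappa>\<in>?E. (\<Prod>l = 0..<p. c (\<kappa> l) (K ! l)) *
          Determinant.det (Matrix.mat p p (\<lambda>(k, l). a (I ! l) (\<kappa> k))))"
        by (rule det_rows_sum[of p "\<lambda>k s. c s (K ! k)"])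
      also have "\<dots> = (\<Sum>\<kappa>\<in>?E. (\<Prod>l = 0..<p. c (\<kappa> l) (K ! l)) * D I \<kappa>)"
      proof (intro sum.cong refl arg_cong2[where f = "(*)"])
        fix \<kappa>
        have "Matrix.mat p p (\<lambda>(k, l). a (I ! l) (\<kappa> k)) =
            Matrix.transpose_mat (Matrix.mat p p (\<lambda>(k, l). a (I ! k) (\<kappa> l)))"
          by (rule eq_matI) auto
        then show "Determinant.det (Matrix.mat p p (\<lambda>(k, l). a (I ! l) (\<kappa> k))) = D I \<kappa>"
          by (simp add: D_def Determinant.det_transpose[OF mat_carrier])
      qed
      finally show ?thesis .
    qed
    have fin: "finite S"
      unfolding S_def
      by (rule finite_subset[OF _ finite_lists_length_eq[of "UNIV :: 'n set" p]]) auto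
    have "\<xi> K = (\<Sum>I\<in>S. \<xi> I * (if I = K then 1 else 0))"
      using fin \<xi>(1) by (simp add: if_distrib[of "\<lambda>z. _ * z"] cong: if_cong)
    also have "\<dots> = (\<Sum>I\<in>S. \<Sum>\<kappa>\<in>?E. (\<Prod>l = 0..<p. c (\<kappa> l) (K ! l)) * (\<xi> I * D I \<kappa>))"
      by (intro sum.cong refl) (simp only: delta sum_distrib_left mult_ac)
    also have "\<dots> = (\<Sum>\<kappa>\<in>?E. (\<Prod>l = 0..<p. c (\<kappa> l) (K ! l)) * T \<kappa>)"
      unfolding T_def by (subst sum.swap) (simp add: sum_distrib_left)
    also have "\<dots> = 0" by (simp add: T0)
    finally show False using \<xi>(2) by simp
  qed
  then obtain \<kappa> where \<kappa>: "\<kappa> \<in> ?E" "T \<kappa> \<noteq> 0" by blast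
  have "(\<Sum>\<kappa>\<in>?E. (cmod (T \<kappa>))\<^sup>2) > 0"
    using \<kappa> by (intro sum_pos2[of ?E \<kappa>]) (auto simp: finite_PiE)
  then show ?thesis unfolding eq[symmetric] by (simp add: zero_less_mult_iff)
qed

lemma metric_factorization:
  fixes g :: "'n::finite cmat"
  assumes g: "hermitian_mat g" and pos: "\<And>x. x \<noteq> 0 \<Longrightarrow> Re (sesq g x x) > 0"
  shows "\<exists>(a :: 'n \<Rightarrow> 'n \<Rightarrow> complex) c. (\<forall>i j. g $ i $ j = (\<Sum>s\<in>UNIV. a i s * cnj (a j s))) \<and>
    (\<forall>i j. (\<Sum>s\<in>UNIV. a i s * c s j) = (if i = j then 1 else 0))"
proof -
  obtain v \<mu> where "pencil_diag g g v \<mu>" using pencil_eigenbasis[OF g g pos] by blast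
  note v = pencil_diagD(1)[OF this]
  define a where "a = (\<lambda>i s. sesq g (axis i 1) (v s))"
  have entry: "sesq g (axis i 1) (axis j 1) = g $ i $ j" for i j
  proof -
    have "sesq g (axis i 1) (axis j 1) = (\<Sum>k\<in>UNIV. if i = k then g $ i $ j else 0)"
      unfolding sesq_def
    proof (intro sum.cong refl)
      fix k
      have "(\<Sum>l\<in>UNIV. g $ k $ l * axis i 1 $ k * cnj (axis j 1 $ l)) =
          (\<Sum>l\<in>UNIV. if j = l then g $ k $ j * axis i 1 $ k else 0)"
        by (intro sum.cong refl) (auto simp: axis_def)
      then show "(\<Sum>l\<in>UNIV. g $ k $ l * axis i 1 $ k * cnj (axis j 1 $ l)) = (if i = k then g $ i $ j else 0)"
        by (auto simp: axis_def)
    qed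
    then show ?thesis by simp
  qed
  show ?thesis
  proof (rule exI[of _ a], rule exI[of _ "\<lambda>s j. v s $ j"], intro conjI allI)
    show "g $ i $ j = (\<Sum>s\<in>UNIV. a i s * cnj (a j s))" for i j
      unfolding a_def entry[symmetric] by (rule sesq_parseval[OF g v])
    have "(\<Sum>s\<in>UNIV. a i s *s v s) = axis i 1" for i
      unfolding a_def by (rule sesq_orthonormal_expansion[OF v, symmetric])
    then have "(\<Sum>s\<in>UNIV. a i s *s v s) $ j = axis i 1 $ j" for i j by simp
    then show "(\<Sum>s\<in>UNIV. a i s * v s $ j) = (if i = j then 1 else 0)" for i j
      by (simp add: axis_def eq_commute)
  qed
qed

lemma metric_minor_mat_pos_def:
  fixes \<omega> :: "'n::{finite,linorder} form" and e :: "nat \<Rightarrow> 'k::finite" and x :: "complex^'k"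
    and a c :: "'n \<Rightarrow> 'n \<Rightarrow> complex"
  assumes e: "bij_betw e {0..<CARD('k)} (UNIV :: 'k set)"
    and len: "length (multi_indices p :: 'n list list) = CARD('k)"
    and g: "\<And>i j. metric_coeff \<omega> i j = (\<Sum>s\<in>UNIV. a i s * cnj (a j s))"
    and ac: "\<And>i j. (\<Sum>s\<in>UNIV. a i s * c s j) = (if i = j then 1 else 0)"
    and x: "x \<noteq> 0"
  shows "Re (sesq (index_mat p e (metric_minor p \<omega>)) x x) > 0"
proof -
  let ?S = "{I :: 'n list. length I = p \<and> sorted_wrt (<) I}"
  let ?\<iota> = "multi_index p e :: 'k \<Rightarrow> 'n list"
  have bij: "bij_betw ?\<iota> UNIV ?S" by (rule bij_betw_multi_index[OF e len])
  define \<xi> where "\<xi> = (\<lambda>I. x $ inv_into UNIV ?\<iota> I)"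
  have \<xi>: "\<xi> (?\<iota> b) = x $ b" for b
    using bij by (simp add: \<xi>_def bij_betw_def inv_into_f_f)
  obtain b where b: "x $ b \<noteq> 0" using x by (auto simp: Finite_Cartesian_Product.vec_eq_iff)
  have "sesq (index_mat p e (metric_minor p \<omega>)) x x =
      (\<Sum>a\<in>UNIV. \<Sum>b\<in>UNIV. metric_minor p \<omega> (?\<iota> a) (?\<iota> b) * \<xi> (?\<iota> a) * cnj (\<xi> (?\<iota> b)))"
    by (simp add: sesq_def index_mat_def \<xi>)
  also have "\<dots> = (\<Sum>I\<in>?S. \<Sum>b\<in>UNIV. metric_minor p \<omega> I (?\<iota> b) * \<xi> I * cnj (\<xi> (?\<iota> b)))"
    by (rule sum.reindex_bij_betw[OF bij])
  also have "\<dots> = (\<Sum>I\<in>?S. \<Sum>J\<in>?S. metric_minor p \<omega> I J * \<xi> I * cnj (\<xi> J))"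
    by (intro sum.cong refl sum.reindex_bij_betw[OF bij])
  finally have eq: "sesq (index_mat p e (metric_minor p \<omega>)) x x =
      (\<Sum>I\<in>?S. \<Sum>J\<in>?S. metric_minor p \<omega> I J * \<xi> I * cnj (\<xi> J))" .
  have "?\<iota> b \<in> ?S" using bij by (auto simp: bij_betw_def)
  moreover have "\<xi> (?\<iota> b) \<noteq> 0" using b by (simp add: \<xi>)
  ultimately show ?thesis unfolding eq by (rule metric_minor_pos_def[OF g ac])
qed

section \<open>Wedge products with positive forms\<close>

lemma shuffle_sign_empty [simp]: "shuffle_sign A {} = 1" "shuffle_sign {} A = 1"
  by (simp_all add: shuffle_sign_def)

lemma wedge_dz_dzbar:
  "wedge (dz i) (dzbar j) I J = (if I = {i} \<and> J = {j} then 1 else 0)"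
proof (cases "I = {i} \<and> J = {j}")
  case True
  then show ?thesis
    by (simp add: wedge_def dz_def dzbar_def Pow_insert)
next
  case False
  have "dz i K L * dzbar j (I - K) (J - L) = 0" if "K \<subseteq> I" "L \<subseteq> J" for K L
    using False that by (auto simp: dz_def dzbar_def)
  then show ?thesis
    using False by (auto simp: wedge_def mult.assoc intro!: sum.neutral)
qed

lemma form11_eq:
  "form11 h I J = (\<Sum>i\<in>UNIV. \<Sum>j\<in>UNIV. if I = {i} \<and> J = {j} then \<i> * h $ i $ j else 0)"
  unfolding form11_def wedge_dz_dzbar sum_distrib_left by (intro sum.cong refl) simp

lemma metric_coeff_form11: "metric_coeff (form11 h) i j = h $ i $ j"
proof -
  have "form11 h {i} {j} = (\<Sum>i'\<in>UNIV. \<Sum>j'\<in>UNIV. if i = i' then if j = j' then \<i> * h $ i' $ j' else 0 else 0)"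
    unfolding form11_eq by (intro sum.cong refl) auto
  also have "\<dots> = (\<Sum>i'\<in>UNIV. if i = i' then \<i> * h $ i' $ j else 0)"
    by (intro sum.cong refl) auto
  also have "\<dots> = \<i> * h $ i $ j" by simp
  finally show ?thesis by (simp add: metric_coeff_def)
qed

lemma form11_support: "form11 h I J \<noteq> 0 \<Longrightarrow> card I = 1 \<and> card J = 1"
proof (rule ccontr)
  assume "form11 h I J \<noteq> 0" and n: "\<not> (card I = 1 \<and> card J = 1)"
  moreover have "form11 h I J = 0"
    unfolding form11_eq using n by (intro sum.neutral ballI) auto
  ultimately show False by blast
qed

text \<open>The sign in \<open>dz\<^sub>i \<and> dz\<^bsub>I - {i}\<^esub> = insertion_sign i I * dz\<^sub>I\<close>, for \<open>i \<in> I\<close>.\<close>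

definition insertion_sign :: "'n::{finite,linorder} \<Rightarrow> 'n set \<Rightarrow> complex" where
  "insertion_sign i I = shuffle_sign {i} (I - {i})"

lemma cnj_insertion_sign [simp]: "cnj (insertion_sign i I) = insertion_sign i I"
  by (simp add: insertion_sign_def shuffle_sign_def)

text \<open>The coefficients of \<open>\<alpha> = \<i>\<^bsup>q\<^sup>2\<^esup> \<Sum> c\<^sub>I\<^sub>J dz\<^sub>I \<and> dzbar\<^sub>J\<close>; for this normalisation, real forms have
  Hermitian coefficients.\<close>

definition qq_coeff :: "nat \<Rightarrow> 'n form \<Rightarrow> 'n set \<Rightarrow> 'n set \<Rightarrow> complex" where
  "qq_coeff q \<alpha> I J = \<alpha> I J / \<i> ^ q\<^sup>2"

lemma sum_Pow_singletons:
  fixes I :: "'n::finite set"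
  assumes "\<And>K. K \<subseteq> I \<Longrightarrow> card K \<noteq> 1 \<Longrightarrow> F K = (0 :: complex)"
  shows "(\<Sum>K\<in>Pow I. F K) = (\<Sum>i\<in>I. F {i})"
proof -
  have "(\<Sum>K\<in>Pow I. F K) = (\<Sum>K\<in>(\<lambda>i. {i}) ` I. F K)"
  proof (rule sum.mono_neutral_right)
    show "\<forall>K\<in>Pow I - (\<lambda>i. {i}) ` I. F K = 0"
    proof
      fix K assume K: "K \<in> Pow I - (\<lambda>i. {i}) ` I"
      then have "card K \<noteq> 1" by (auto simp: card_1_singleton_iff)
      then show "F K = 0" using assms K by auto
    qed
  qed auto
  also have "\<dots> = (\<Sum>i\<in>I. F {i})" by (subst sum.reindex) auto
  finally show ?thesis .
qed

lemma qq_coeff_wedge: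
  fixes \<alpha> \<beta> :: "'n::{finite,linorder} form"
  assumes supp: "\<And>K L. \<alpha> K L \<noteq> 0 \<Longrightarrow> card K = 1 \<and> card L = 1"
    and I: "card I = Suc q"
  shows "qq_coeff (Suc q) (wedge \<alpha> \<beta>) I J = (\<Sum>i\<in>I. \<Sum>j\<in>J.
    insertion_sign i I * insertion_sign j J * metric_coeff \<alpha> i j * qq_coeff q \<beta> (I - {i}) (J - {j}))"
proof -
  have z: "\<alpha> K L = 0" if "card K \<noteq> 1 \<or> card L \<noteq> 1" for K L using supp that by blast
  \<comment> \<open>The sign from moving \<open>dz\<close> past \<open>dzbar\<close> is absorbed by the normalisation: \<open>(q+1)\<^sup>2 = q\<^sup>2 + 2q + 1\<close>.\<close>
  have unit: "(-1) ^ q * x / \<i> ^ (Suc q)\<^sup>2 = x / \<i> / \<i> ^ q\<^sup>2" for x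
  proof -
    have "\<i> ^ (Suc q)\<^sup>2 = \<i> ^ q\<^sup>2 * (\<i> ^ 2) ^ q * \<i>"
      by (simp only: power_mult[symmetric] power_add[symmetric] power_Suc2[symmetric])
        (simp add: power2_eq_square algebra_simps mult_2_right)
    also have "\<dots> = \<i> ^ q\<^sup>2 * (-1) ^ q * \<i>" by simp
    finally show ?thesis by (simp add: divide_simps mult_ac)
  qed
  have "wedge \<alpha> \<beta> I J = (\<Sum>i\<in>I. \<Sum>j\<in>J. (- 1) ^ card (I - {i}) * insertion_sign i I *
      insertion_sign j J * \<alpha> {i} {j} * \<beta> (I - {i}) (J - {j}))"
    unfolding wedge_def insertion_sign_def
    by (subst sum_Pow_singletons, simp add: z, intro sum.cong refl, subst sum_Pow_singletons)
      (auto simp: z)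
  also have "\<dots> = (\<Sum>i\<in>I. \<Sum>j\<in>J. (- 1) ^ q * insertion_sign i I *
      insertion_sign j J * \<alpha> {i} {j} * \<beta> (I - {i}) (J - {j}))"
    using I by (intro sum.cong refl) simp
  finally have "wedge \<alpha> \<beta> I J = (\<Sum>i\<in>I. \<Sum>j\<in>J. (- 1) ^ q * (insertion_sign i I *
      insertion_sign j J * \<alpha> {i} {j} * \<beta> (I - {i}) (J - {j})))"
    by (simp only: mult.assoc)
  then show ?thesis
    unfolding qq_coeff_def metric_coeff_def
    by (simp only: sum_divide_distrib unit) (simp add: mult_ac)
qed

text \<open>Hermitian symmetry of the coefficients of the \<open>(q,q)\<close> part of a form.\<close>

definition hermitian_qq :: "nat \<Rightarrow> 'n form \<Rightarrow> bool" where
  "hermitian_qq q \<alpha> \<longleftrightarrow>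
     (\<forall>I J. card I = q \<longrightarrow> card J = q \<longrightarrow> qq_coeff q \<alpha> J I = cnj (qq_coeff q \<alpha> I J))"

text \<open>Nonnegativity of the Hermitian form given by the coefficients of the \<open>(q,q)\<close> part.\<close>

definition nonneg_qq :: "nat \<Rightarrow> 'n form \<Rightarrow> bool" where
  "nonneg_qq q \<alpha> \<longleftrightarrow>
     (\<forall>\<xi>. Re (\<Sum>I | card I = q. \<Sum>J | card J = q. qq_coeff q \<alpha> I J * \<xi> I * cnj (\<xi> J)) \<ge> 0)"

lemma hermitian_qq_wedge:
  fixes \<alpha> \<beta> :: "'n::{finite,linorder} form"
  assumes supp: "\<And>K L. \<alpha> K L \<noteq> 0 \<Longrightarrow> card K = 1 \<and> card L = 1"
    and h: "\<And>i j. metric_coeff \<alpha> j i = cnj (metric_coeff \<alpha> i j)"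
    and \<beta>: "hermitian_qq q \<beta>"
  shows "hermitian_qq (Suc q) (wedge \<alpha> \<beta>)"
  unfolding hermitian_qq_def
proof (intro allI impI)
  fix I J :: "'n set" assume I: "card I = Suc q" and J: "card J = Suc q"
  have "qq_coeff (Suc q) (wedge \<alpha> \<beta>) J I = (\<Sum>j\<in>J. \<Sum>i\<in>I.
    insertion_sign j J * insertion_sign i I * metric_coeff \<alpha> j i * qq_coeff q \<beta> (J - {j}) (I - {i}))"
    by (rule qq_coeff_wedge[OF supp J])
  also have "\<dots> = (\<Sum>j\<in>J. \<Sum>i\<in>I. cnj (insertion_sign i I * insertion_sign j J *
      metric_coeff \<alpha> i j * qq_coeff q \<beta> (I - {i}) (J - {j})))"
  proof (intro sum.cong refl)
    fix i j assume "i \<in> I" "j \<in> J"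
    then have "qq_coeff q \<beta> (J - {j}) (I - {i}) = cnj (qq_coeff q \<beta> (I - {i}) (J - {j}))"
      using \<beta>[unfolded hermitian_qq_def, rule_format, of "I - {i}" "J - {j}"] I J by simp
    then show "insertion_sign j J * insertion_sign i I * metric_coeff \<alpha> j i * qq_coeff q \<beta> (J - {j}) (I - {i}) =
      cnj (insertion_sign i I * insertion_sign j J * metric_coeff \<alpha> i j * qq_coeff q \<beta> (I - {i}) (J - {j}))"
      by (simp add: h[of j i])
  qed
  also have "\<dots> = cnj (qq_coeff (Suc q) (wedge \<alpha> \<beta>) I J)"
  proof -
    have "qq_coeff (Suc q) (wedge \<alpha> \<beta>) I J = (\<Sum>i\<in>I. \<Sum>j\<in>J.
        insertion_sign i I * insertion_sign j J * metric_coeff \<alpha> i j * qq_coeff q \<beta> (I - {i}) (J - {j}))"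
      by (rule qq_coeff_wedge[OF supp I])
    then show ?thesis by (subst sum.swap) simp
  qed
  finally show "qq_coeff (Suc q) (wedge \<alpha> \<beta>) J I = cnj (qq_coeff (Suc q) (wedge \<alpha> \<beta>) I J)" .
qed

text \<open>Pairs \<open>(I, i)\<close> with \<open>i \<in> I\<close> correspond to pairs \<open>(I - {i}, i)\<close>.\<close>

lemma sum_remove_element:
  fixes G :: "'n::finite set \<Rightarrow> 'n \<Rightarrow> 'n set \<Rightarrow> complex"
  shows "(\<Sum>I | card I = Suc q. \<Sum>i\<in>I. G I i (I - {i})) = (\<Sum>I | card I = q. \<Sum>i\<in>- I. G (insert i I) i I)"
proof -
  have "(\<Sum>I | card I = Suc q. \<Sum>i\<in>I. G I i (I - {i})) =
      (\<Sum>(I, i)\<in>(SIGMA I:{I. card I = Suc q}. I). G I i (I - {i}))"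
    by (rule sum.Sigma) auto
  also have "\<dots> = (\<Sum>(I, i)\<in>(SIGMA I:{I. card I = q}. - I). G (insert i I) i I)"
    by (rule sum.reindex_bij_witness[where i = "\<lambda>(I, i). (insert i I, i)" and j = "\<lambda>(I, i). (I - {i}, i)"])
      (auto simp: insert_absorb)
  also have "\<dots> = (\<Sum>I | card I = q. \<Sum>i\<in>- I. G (insert i I) i I)"
    by (rule sum.Sigma[symmetric]) auto
  finally show ?thesis .
qed

text \<open>For \<open>\<alpha> = \<i> \<Sum>\<^sub>k a\<^sub>k \<and> conj a\<^sub>k\<close>, the Hermitian form of \<open>\<alpha> \<and> \<beta>\<close> at \<open>\<xi>\<close> is the sum over \<open>k\<close> of
  that of \<open>\<beta>\<close> at the contraction of \<open>\<xi>\<close> with \<open>a\<^sub>k\<close>.\<close>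

lemma nonneg_qq_wedge:
  fixes \<alpha> \<beta> :: "'n::{finite,linorder} form" and a :: "'s \<Rightarrow> 'n \<Rightarrow> complex"
  assumes supp: "\<And>K L. \<alpha> K L \<noteq> 0 \<Longrightarrow> card K = 1 \<and> card L = 1"
    and a: "\<And>i j. metric_coeff \<alpha> i j = (\<Sum>k\<in>S. a k i * cnj (a k j))"
    and \<beta>: "nonneg_qq q \<beta>"
  shows "nonneg_qq (Suc q) (wedge \<alpha> \<beta>)"
  unfolding nonneg_qq_def
proof
  fix \<xi> :: "'n set \<Rightarrow> complex"
  define \<eta> where "\<eta> = (\<lambda>k I. \<Sum>i\<in>- I. insertion_sign i (insert i I) * a k i * \<xi> (insert i I))"
  have "(\<Sum>I | card I = Suc q. \<Sum>J | card J = Suc q. qq_coeff (Suc q) (wedge \<alpha> \<beta>) I J * \<xi> I * cnj (\<xi> J)) =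
    (\<Sum>I | card I = Suc q. \<Sum>J | card J = Suc q. \<Sum>i\<in>I. \<Sum>j\<in>J. \<Sum>k\<in>S. qq_coeff q \<beta> (I - {i}) (J - {j}) *
        (insertion_sign i I * a k i * \<xi> I) * cnj (insertion_sign j J * a k j * \<xi> J))"
    by (intro sum.cong refl)
      (simp add: qq_coeff_wedge[OF supp] a sum_distrib_left sum_distrib_right mult_ac)
  also have "\<dots> = (\<Sum>I | card I = Suc q. \<Sum>i\<in>I. \<Sum>J | card J = Suc q. \<Sum>j\<in>J. \<Sum>k\<in>S. qq_coeff q \<beta> (I - {i}) (J - {j}) *
        (insertion_sign i I * a k i * \<xi> I) * cnj (insertion_sign j J * a k j * \<xi> J))"
    by (intro sum.cong refl sum.swap)
  also have "\<dots> = (\<Sum>I | card I = q. \<Sum>i\<in>- I. \<Sum>J | card J = Suc q. \<Sum>j\<in>J. \<Sum>k\<in>S. qq_coeff q \<beta> I (J - {j}) *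
        (insertion_sign i (insert i I) * a k i * \<xi> (insert i I)) * cnj (insertion_sign j J * a k j * \<xi> J))"
    by (rule sum_remove_element[where G = "\<lambda>I i I'. \<Sum>J | card J = Suc q. \<Sum>j\<in>J. \<Sum>k\<in>S. qq_coeff q \<beta> I' (J - {j}) *
        (insertion_sign i I * a k i * \<xi> I) * cnj (insertion_sign j J * a k j * \<xi> J)"])
  also have "\<dots> = (\<Sum>I | card I = q. \<Sum>i\<in>- I. \<Sum>J | card J = q. \<Sum>j\<in>- J. \<Sum>k\<in>S. qq_coeff q \<beta> I J *
        (insertion_sign i (insert i I) * a k i * \<xi> (insert i I)) *
        cnj (insertion_sign j (insert j J) * a k j * \<xi> (insert j J)))"
    by (intro sum.cong refl sum_remove_element[where G = "\<lambda>J j J'. \<Sum>k\<in>S. qq_coeff q \<beta> _ J' *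
        (insertion_sign _ (insert _ _) * a k _ * \<xi> (insert _ _)) * cnj (insertion_sign j J * a k j * \<xi> J)"])
  also have "\<dots> = (\<Sum>I | card I = q. \<Sum>J | card J = q. \<Sum>i\<in>- I. \<Sum>j\<in>- J. \<Sum>k\<in>S. qq_coeff q \<beta> I J *
        (insertion_sign i (insert i I) * a k i * \<xi> (insert i I)) *
        cnj (insertion_sign j (insert j J) * a k j * \<xi> (insert j J)))"
    by (intro sum.cong refl sum.swap)
  also have "\<dots> = (\<Sum>I | card I = q. \<Sum>J | card J = q. \<Sum>k\<in>S. qq_coeff q \<beta> I J * \<eta> k I * cnj (\<eta> k J))"
  proof (intro sum.cong refl)
    fix I J
    let ?t = "\<lambda>k i I. insertion_sign i (insert i I) * a k i * \<xi> (insert i I)"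
    have "(\<Sum>i\<in>- I. \<Sum>j\<in>- J. \<Sum>k\<in>S. qq_coeff q \<beta> I J * ?t k i I * cnj (?t k j J)) =
      (\<Sum>i\<in>- I. \<Sum>k\<in>S. \<Sum>j\<in>- J. qq_coeff q \<beta> I J * ?t k i I * cnj (?t k j J))"
      by (intro sum.cong refl sum.swap)
    also have "\<dots> = (\<Sum>k\<in>S. \<Sum>i\<in>- I. \<Sum>j\<in>- J. qq_coeff q \<beta> I J * ?t k i I * cnj (?t k j J))"
      by (rule sum.swap)
    also have "\<dots> = (\<Sum>k\<in>S. qq_coeff q \<beta> I J * ((\<Sum>i\<in>- I. ?t k i I) * (\<Sum>j\<in>- J. cnj (?t k j J))))"
      unfolding sum_product by (simp only: sum_distrib_left mult.assoc)
    also have "\<dots> = (\<Sum>k\<in>S. qq_coeff q \<beta> I J * \<eta> k I * cnj (\<eta> k J))"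
      by (simp only: \<eta>_def cnj_sum mult.assoc)
    finally show "(\<Sum>i\<in>- I. \<Sum>j\<in>- J. \<Sum>k\<in>S. qq_coeff q \<beta> I J * ?t k i I * cnj (?t k j J)) =
      (\<Sum>k\<in>S. qq_coeff q \<beta> I J * \<eta> k I * cnj (\<eta> k J))" .
  qed
  also have "\<dots> = (\<Sum>I | card I = q. \<Sum>k\<in>S. \<Sum>J | card J = q. qq_coeff q \<beta> I J * \<eta> k I * cnj (\<eta> k J))"
    by (intro sum.cong refl sum.swap)
  also have "\<dots> = (\<Sum>k\<in>S. \<Sum>I | card I = q. \<Sum>J | card J = q. qq_coeff q \<beta> I J * \<eta> k I * cnj (\<eta> k J))"
    by (rule sum.swap)
  finally have eq: "(\<Sum>I | card I = Suc q. \<Sum>J | card J = Suc q. qq_coeff (Suc q) (wedge \<alpha> \<beta>) I J * \<xi> I * cnj (\<xi> J)) =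
    (\<Sum>k\<in>S. \<Sum>I | card I = q. \<Sum>J | card J = q. qq_coeff q \<beta> I J * \<eta> k I * cnj (\<eta> k J))" .
  show "Re (\<Sum>I | card I = Suc q. \<Sum>J | card J = Suc q. qq_coeff (Suc q) (wedge \<alpha> \<beta>) I J * \<xi> I * cnj (\<xi> J)) \<ge> 0"
    unfolding eq Re_sum[of _ S] using \<beta> by (intro sum_nonneg) (auto simp only: nonneg_qq_def)
qed

lemma wedge_power_hermitian_nonneg:
  fixes \<omega> :: "'n::{finite,linorder} form" and a :: "'s \<Rightarrow> 'n \<Rightarrow> complex"
  assumes supp: "\<And>K L. \<omega> K L \<noteq> 0 \<Longrightarrow> card K = 1 \<and> card L = 1"
    and a: "\<And>i j. metric_coeff \<omega> i j = (\<Sum>k\<in>S. a k i * cnj (a k j))"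
  shows "hermitian_qq q (wedge_power \<omega> q)" and "nonneg_qq q (wedge_power \<omega> q)"
proof -
  have h: "metric_coeff \<omega> j i = cnj (metric_coeff \<omega> i j)" for i j
    by (simp add: a mult.commute)
  have "hermitian_qq q (wedge_power \<omega> q) \<and> nonneg_qq q (wedge_power \<omega> q)"
  proof (induction q)
    case 0
    have "{I :: 'n set. card I = 0} = {{}}" by auto
    then show ?case
      by (auto simp: hermitian_qq_def nonneg_qq_def wedge_power_def wedge_list_def qq_coeff_def unit_form_def
          complex_norm_square[symmetric])
  next
    case (Suc q)
    have "wedge_power \<omega> (Suc q) = wedge \<omega> (wedge_power \<omega> q)"
      by (simp add: wedge_power_def wedge_list_def)
    then show ?case
      using Suc hermitian_qq_wedge[OF supp h] nonneg_qq_wedge[OF supp a] by metis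
  qed
  then show "hermitian_qq q (wedge_power \<omega> q)" "nonneg_qq q (wedge_power \<omega> q)" by auto
qed

lemma pp_coeff_qq_coeff: "pp_coeff p \<alpha> I J = qq_coeff p \<alpha> (set I) (set J) / fact p"
  by (simp add: pp_coeff_def qq_coeff_def)

lemma bij_betw_set_multi_index:
  fixes e :: "nat \<Rightarrow> 'k::finite"
  assumes e: "bij_betw e {0..<CARD('k)} (UNIV :: 'k set)"
    and len: "length (multi_indices p :: 'n::{finite,linorder} list list) = CARD('k)"
  shows "bij_betw (\<lambda>a. set (multi_index p e a)) UNIV {I :: 'n set. card I = p}"
  using bij_betw_trans[OF bij_betw_multi_index[OF e len] bij_betw_set_increasing_lists]
  by (simp add: comp_def)

lemma card_set_multi_index:
  fixes e :: "nat \<Rightarrow> 'k::finite"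
  assumes e: "bij_betw e {0..<CARD('k)} (UNIV :: 'k set)"
    and len: "length (multi_indices p :: 'n::{finite,linorder} list list) = CARD('k)"
  shows "card (set (multi_index p e a :: 'n list)) = p"
  using bij_betw_set_multi_index[OF e len] by (auto simp: bij_betw_def)

lemma hermitian_index_mat:
  fixes \<alpha> :: "'n::{finite,linorder} form" and e :: "nat \<Rightarrow> 'k::finite"
  assumes e: "bij_betw e {0..<CARD('k)} (UNIV :: 'k set)"
    and len: "length (multi_indices p :: 'n list list) = CARD('k)"
    and \<alpha>: "hermitian_qq p \<alpha>"
  shows "hermitian_mat (index_mat p e (pp_coeff p \<alpha>))"
  unfolding hermitian_mat_def
proof (intro allI)
  fix a b
  have "qq_coeff p \<alpha> (set (multi_index p e b)) (set (multi_index p e a)) =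
      cnj (qq_coeff p \<alpha> (set (multi_index p e a)) (set (multi_index p e b)))"
    using \<alpha> card_set_multi_index[OF e len] unfolding hermitian_qq_def by blast
  then show "index_mat p e (pp_coeff p \<alpha>) $ b $ a = cnj (index_mat p e (pp_coeff p \<alpha>) $ a $ b)"
    by (simp add: index_mat_def pp_coeff_qq_coeff)
qed

lemma nonneg_index_mat:
  fixes \<alpha> :: "'n::{finite,linorder} form" and e :: "nat \<Rightarrow> 'k::finite"
  assumes e: "bij_betw e {0..<CARD('k)} (UNIV :: 'k set)"
    and len: "length (multi_indices p :: 'n list list) = CARD('k)"
    and \<alpha>: "nonneg_qq p \<alpha>"
  shows "Re (sesq (index_mat p e (pp_coeff p \<alpha>)) x x) \<ge> 0"
proof -
  let ?\<iota> = "\<lambda>a. set (multi_index p e a :: 'n list)"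
  have bij: "bij_betw ?\<iota> (UNIV :: 'k set) {I. card I = p}"
    by (rule bij_betw_set_multi_index[OF e len])
  define \<xi> where "\<xi> = (\<lambda>I. x $ inv_into UNIV ?\<iota> I)"
  have \<xi>: "\<xi> (?\<iota> b) = x $ b" for b
    using bij unfolding \<xi>_def bij_betw_def by (metis UNIV_I inv_into_f_f)
  have "fact p * sesq (index_mat p e (pp_coeff p \<alpha>)) x x =
      (\<Sum>a\<in>UNIV. \<Sum>b\<in>UNIV. qq_coeff p \<alpha> (?\<iota> a) (?\<iota> b) * \<xi> (?\<iota> a) * cnj (\<xi> (?\<iota> b)))"
    by (simp add: sesq_def index_mat_def pp_coeff_qq_coeff \<xi> sum_distrib_left)
  also have "\<dots> = (\<Sum>I | card I = p. \<Sum>b\<in>UNIV. qq_coeff p \<alpha> I (?\<iota> b) * \<xi> I * cnj (\<xi> (?\<iota> b)))"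
    by (rule sum.reindex_bij_betw[OF bij])
  also have "\<dots> = (\<Sum>I | card I = p. \<Sum>J | card J = p. qq_coeff p \<alpha> I J * \<xi> I * cnj (\<xi> J))"
    by (intro sum.cong refl sum.reindex_bij_betw[OF bij])
  finally have "Re (fact p * sesq (index_mat p e (pp_coeff p \<alpha>)) x x) \<ge> 0"
    using \<alpha> by (simp only: nonneg_qq_def)
  moreover have "fact p = complex_of_real (fact p)" by simp
  ultimately have "fact p * Re (sesq (index_mat p e (pp_coeff p \<alpha>)) x x) \<ge> 0"
    by (simp only: times_complex.sel Re_complex_of_real Im_complex_of_real mult_zero_left diff_zero)
  then show ?thesis by (metis fact_gt_zero mult_le_cancel_left_pos mult_zero_right)
qed

lemma real_pp_form_hermitian:
  assumes "real_pp_form p \<alpha>"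
  shows "hermitian_qq p \<alpha>"
  unfolding hermitian_qq_def
proof (intro allI impI)
  fix I J :: "'a set" assume I: "card I = p" and J: "card J = p"
  have "form_conj \<alpha> J I = \<alpha> J I" using assms by (simp add: real_pp_form_def)
  then have 1: "\<alpha> J I = (-1) ^ p\<^sup>2 * cnj (\<alpha> I J)" by (simp add: form_conj_def I J power2_eq_square)
  have 2: "cnj (\<i> ^ p\<^sup>2) = (-1) ^ p\<^sup>2 * \<i> ^ p\<^sup>2"
    by (simp add: power_mult_distrib[symmetric])
  have "((-1) ^ p\<^sup>2 * (-1) ^ p\<^sup>2 :: complex) = 1" by (simp add: power_mult_distrib[symmetric])
  then show "qq_coeff p \<alpha> J I = cnj (qq_coeff p \<alpha> I J)"
    unfolding qq_coeff_def complex_cnj_divide 1 2 by (simp add: field_simps)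
qed

lemma real_11_form_hermitian:
  assumes "real_pp_form 1 \<omega>"
  shows "metric_coeff \<omega> j i = cnj (metric_coeff \<omega> i j)"
proof -
  have "qq_coeff 1 \<omega> {j} {i} = cnj (qq_coeff 1 \<omega> {i} {j})"
    using real_pp_form_hermitian[OF assms] unfolding hermitian_qq_def
    by (metis One_nat_def card.empty card_insert_disjoint empty_iff finite.emptyI)
  then show ?thesis by (simp add: qq_coeff_def metric_coeff_def)
qed

text \<open>The coefficient matrix of \<open>h \<and> \<omega>\<^bsup>p-1\<^esup>\<close> is \<open>\<Sum> h\<^sub>i\<^sub>j wedge_mat p e \<omega> i j\<close>.\<close>

definition wedge_mat ::
  "nat \<Rightarrow> (nat \<Rightarrow> 'k::finite) \<Rightarrow> 'n::{finite,linorder} form \<Rightarrow> 'n \<Rightarrow> 'n \<Rightarrow> 'k cmat" where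
  "wedge_mat p e \<omega> i j = (\<chi> a b. let I = set (multi_index p e a); J = set (multi_index p e b) in
     if i \<in> I \<and> j \<in> J then insertion_sign i I * insertion_sign j J *
       qq_coeff (p - 1) (wedge_power \<omega> (p - 1)) (I - {i}) (J - {j}) / fact p else 0)"

lemma index_mat_wedge:
  fixes \<omega> :: "'n::{finite,linorder} form" and e :: "nat \<Rightarrow> 'k::finite"
  assumes e: "bij_betw e {0..<CARD('k)} (UNIV :: 'k set)"
    and len: "length (multi_indices p :: 'n list list) = CARD('k)" and p: "p \<ge> 1"
  shows "index_mat p e (pp_coeff p (wedge (form11 h) (wedge_power \<omega> (p - 1)))) $ a $ b =
    (\<Sum>i\<in>UNIV. \<Sum>j\<in>UNIV. h $ i $ j * wedge_mat p e \<omega> i j $ a $ b)"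
proof -
  define I where "I = set (multi_index p e a :: 'n list)"
  define J where "J = set (multi_index p e b :: 'n list)"
  let ?\<beta> = "wedge_power \<omega> (p - 1)"
  let ?t = "\<lambda>i j. insertion_sign i I * insertion_sign j J * h $ i $ j * qq_coeff (p - 1) ?\<beta> (I - {i}) (J - {j})"
  have restrict: "(\<Sum>i\<in>A. F i) = (\<Sum>i\<in>UNIV. if i \<in> A then F i else 0)" for A :: "'n set" and F :: "'n \<Rightarrow> complex"
    by (simp add: sum.If_cases)
  have I: "card I = Suc (p - 1)"
    using card_set_multi_index[OF e len, of a] p by (simp add: I_def)
  have "qq_coeff (Suc (p - 1)) (wedge (form11 h) ?\<beta>) I J =
      (\<Sum>i\<in>I. \<Sum>j\<in>J. insertion_sign i I * insertion_sign j J * metric_coeff (form11 h) i j *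
        qq_coeff (p - 1) ?\<beta> (I - {i}) (J - {j}))"
    by (rule qq_coeff_wedge[OF form11_support I])
  also have "\<dots> = (\<Sum>i\<in>I. \<Sum>j\<in>J. ?t i j)" by (simp only: metric_coeff_form11)
  also have "\<dots> = (\<Sum>i\<in>UNIV. \<Sum>j\<in>UNIV. if i \<in> I then if j \<in> J then ?t i j else 0 else 0)"
    unfolding restrict[of _ I] restrict[of _ J] by (intro sum.cong refl) simp
  finally have "index_mat p e (pp_coeff p (wedge (form11 h) ?\<beta>)) $ a $ b =
      (\<Sum>i\<in>UNIV. \<Sum>j\<in>UNIV. if i \<in> I then if j \<in> J then ?t i j else 0 else 0) / fact p"
    using p by (simp add: index_mat_def pp_coeff_qq_coeff I_def J_def)
  also have "\<dots> = (\<Sum>i\<in>UNIV. \<Sum>j\<in>UNIV. h $ i $ j * wedge_mat p e \<omega> i j $ a $ b)"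
    unfolding sum_divide_distrib
    by (intro sum.cong refl) (auto simp: wedge_mat_def Let_def I_def J_def)
  finally show ?thesis .
qed

lemma sesq_index_mat_wedge:
  fixes \<omega> :: "'n::{finite,linorder} form" and e :: "nat \<Rightarrow> 'k::finite"
  assumes e: "bij_betw e {0..<CARD('k)} (UNIV :: 'k set)"
    and len: "length (multi_indices p :: 'n list list) = CARD('k)" and p: "p \<ge> 1"
  shows "sesq (index_mat p e (pp_coeff p (wedge (form11 h) (wedge_power \<omega> (p - 1))))) x y =
    (\<Sum>i\<in>UNIV. \<Sum>j\<in>UNIV. h $ i $ j * sesq (wedge_mat p e \<omega> i j) x y)"
proof -
  have "sesq (index_mat p e (pp_coeff p (wedge (form11 h) (wedge_power \<omega> (p - 1))))) x y =
    (\<Sum>a\<in>UNIV. \<Sum>b\<in>UNIV. \<Sum>i\<in>UNIV. \<Sum>j\<in>UNIV. h $ i $ j * (wedge_mat p e \<omega> i j $ a $ b * x $ a * cnj (y $ b)))"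
    unfolding sesq_def index_mat_wedge[OF e len p] by (simp add: sum_distrib_right mult.assoc)
  also have "\<dots> = (\<Sum>a\<in>UNIV. \<Sum>i\<in>UNIV. \<Sum>b\<in>UNIV. \<Sum>j\<in>UNIV. h $ i $ j * (wedge_mat p e \<omega> i j $ a $ b * x $ a * cnj (y $ b)))"
    by (intro sum.cong refl sum.swap)
  also have "\<dots> = (\<Sum>i\<in>UNIV. \<Sum>a\<in>UNIV. \<Sum>b\<in>UNIV. \<Sum>j\<in>UNIV. h $ i $ j * (wedge_mat p e \<omega> i j $ a $ b * x $ a * cnj (y $ b)))"
    by (rule sum.swap)
  also have "\<dots> = (\<Sum>i\<in>UNIV. \<Sum>a\<in>UNIV. \<Sum>j\<in>UNIV. \<Sum>b\<in>UNIV. h $ i $ j * (wedge_mat p e \<omega> i j $ a $ b * x $ a * cnj (y $ b)))"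
    by (intro sum.cong refl sum.swap)
  also have "\<dots> = (\<Sum>i\<in>UNIV. \<Sum>j\<in>UNIV. \<Sum>a\<in>UNIV. \<Sum>b\<in>UNIV. h $ i $ j * (wedge_mat p e \<omega> i j $ a $ b * x $ a * cnj (y $ b)))"
    by (intro sum.cong refl sum.swap)
  also have "\<dots> = (\<Sum>i\<in>UNIV. \<Sum>j\<in>UNIV. h $ i $ j * sesq (wedge_mat p e \<omega> i j) x y)"
    by (simp add: sesq_def sum_distrib_left)
  finally show ?thesis .
qed

lemma sesq_wedge_mat_cnj:
  fixes \<omega> :: "'n::{finite,linorder} form" and e :: "nat \<Rightarrow> 'k::finite"
  assumes e: "bij_betw e {0..<CARD('k)} (UNIV :: 'k set)"
    and len: "length (multi_indices p :: 'n list list) = CARD('k)"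
    and \<omega>: "hermitian_qq (p - 1) (wedge_power \<omega> (p - 1))"
  shows "sesq (wedge_mat p e \<omega> j i) x x = cnj (sesq (wedge_mat p e \<omega> i j) x x)"
proof -
  have entry: "wedge_mat p e \<omega> j i $ b $ a = cnj (wedge_mat p e \<omega> i j $ a $ b)" for a b
  proof -
    define I where "I = set (multi_index p e a :: 'n list)"
    define J where "J = set (multi_index p e b :: 'n list)"
    have "card I = p" "card J = p"
      using card_set_multi_index[OF e len] by (auto simp: I_def J_def)
    then have "qq_coeff (p - 1) (wedge_power \<omega> (p - 1)) (J - {j}) (I - {i}) =
        cnj (qq_coeff (p - 1) (wedge_power \<omega> (p - 1)) (I - {i}) (J - {j}))" if "i \<in> I" "j \<in> J"
      using \<omega>[unfolded hermitian_qq_def, rule_format, of "I - {i}" "J - {j}"] that by simp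
    then show ?thesis
      by (auto simp: wedge_mat_def Let_def I_def[symmetric] J_def[symmetric])
  qed
  have "sesq (wedge_mat p e \<omega> j i) x x = (\<Sum>b\<in>UNIV. \<Sum>a\<in>UNIV. cnj (wedge_mat p e \<omega> i j $ a $ b * x $ a * cnj (x $ b)))"
    unfolding sesq_def by (intro sum.cong refl) (simp add: entry)
  also have "\<dots> = cnj (sesq (wedge_mat p e \<omega> i j) x x)"
    unfolding sesq_def by (subst sum.swap) simp
  finally show ?thesis .
qed

section \<open>The gradient matrix and its positivity\<close>

text \<open>The statement at one point of one chart. The constant \<open>r\<close> stands for the value of \<open>\<psi>\<close>.\<close>

lemma gradient_exists_at_point:
  fixes \<omega> \<Omega> :: "'n::{finite,linorder} form" and \<Gamma> :: "(real^'k) set" and f :: "real^'k \<Rightarrow> real"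
  assumes card: "CARD('k) = CARD('n) choose p" and p: "p \<ge> 1"
    and \<omega>: "real_pp_form 1 \<omega>"
    and \<omega>_pos: "\<And>\<xi>. \<xi> \<noteq> 0 \<Longrightarrow> Re (\<Sum>i\<in>UNIV. \<Sum>j\<in>UNIV. metric_coeff \<omega> i j * \<xi> $ i * cnj (\<xi> $ j)) > 0"
    and \<Omega>: "real_pp_form p \<Omega>"
    and \<Gamma>: "open \<Gamma>" "symmetric_set \<Gamma>"
    and f: "\<And>x. x \<in> \<Gamma> \<Longrightarrow> f differentiable (at x)" "symmetric_function_on \<Gamma> f"
      "\<And>x a. x \<in> \<Gamma> \<Longrightarrow> partial_deriv f a x \<ge> 0"
    and h: "hermitian_mat h" and adm: "eigenvalues p \<omega> (perturbed p \<omega> \<Omega> h) \<in> \<Gamma>"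
  shows "\<exists>D. has_gradient_matrix (\<lambda>k. f (eigenvalues p \<omega> (perturbed p \<omega> \<Omega> k)) - r) D h \<and> pos_semidefinite D"
proof -
  have len: "length (multi_indices p :: 'n list list) = CARD('k)"
    by (simp add: card length_multi_indices)
  obtain e where e: "bij_betw e {0..<CARD('k)} (UNIV :: 'k set)"
    using ex_bij_betw_nat_finite[of "UNIV :: 'k set"] by auto
  define g :: "'n cmat" where "g = (\<chi> i j. metric_coeff \<omega> i j)"
  have g_herm: "hermitian_mat g"
    unfolding hermitian_mat_def g_def vec_lambda_beta by (intro allI real_11_form_hermitian \<omega>)
  have g_pos: "Re (sesq g x x) > 0" if "x \<noteq> 0" for x
    using \<omega>_pos[OF that] by (simp add: sesq_def g_def)
  obtain a c :: "'n \<Rightarrow> 'n \<Rightarrow> complex" where g_a: "\<And>i j. g $ i $ j = (\<Sum>s\<in>UNIV. a i s * cnj (a j s))"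
    and ac: "\<And>i j. (\<Sum>s\<in>UNIV. a i s * c s j) = (if i = j then 1 else 0)"
    using metric_factorization[OF g_herm g_pos] by auto
  have a: "metric_coeff \<omega> i j = (\<Sum>s\<in>UNIV. a i s * cnj (a j s))" for i j
    using g_a[of i j] by (simp add: g_def)
  have \<omega>_supp: "card K = 1 \<and> card L = 1" if "\<omega> K L \<noteq> 0" for K L
    using \<omega> that by (simp add: real_pp_form_def)
  have pow: "hermitian_qq (p - 1) (wedge_power \<omega> (p - 1))" "nonneg_qq (p - 1) (wedge_power \<omega> (p - 1))"
    using wedge_power_hermitian_nonneg[where a = "\<lambda>s i. a i s" and S = UNIV, OF \<omega>_supp a] by blast+

  define W :: "'k cmat" where "W = index_mat p e (metric_minor p \<omega>)"
  define L :: "'n cmat \<Rightarrow> 'k cmat" where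
    "L = (\<lambda>k. index_mat p e (pp_coeff p (wedge (form11 k) (wedge_power \<omega> (p - 1)))))"
  define A :: "'n cmat \<Rightarrow> 'k cmat" where "A = (\<lambda>k. index_mat p e (pp_coeff p (perturbed p \<omega> \<Omega> k)))"
  have W: "hermitian_mat W"
    unfolding hermitian_mat_def W_def index_mat_def vec_lambda_beta
    by (intro allI metric_minor_hermitian real_11_form_hermitian \<omega>)
  have W_pos: "Re (sesq W x x) > 0" if "x \<noteq> 0" for x
    unfolding W_def by (rule metric_minor_mat_pos_def[OF e len a ac that])
  have A_L: "A k = index_mat p e (pp_coeff p \<Omega>) + L k" for k
    by (simp add: A_def L_def index_mat_def pp_coeff_def perturbed_def form_add_def
        Finite_Cartesian_Product.vec_eq_iff add_divide_distrib)
  have L_entry: "L k $ x $ y = (\<Sum>i\<in>UNIV. \<Sum>j\<in>UNIV. k $ i $ j * wedge_mat p e \<omega> i j $ x $ y)" for k x y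
    unfolding L_def by (rule index_mat_wedge[OF e len p])
  have L_sesq: "sesq (L k) x y = (\<Sum>i\<in>UNIV. \<Sum>j\<in>UNIV. k $ i $ j * sesq (wedge_mat p e \<omega> i j) x y)" for k x y
    unfolding L_def by (rule sesq_index_mat_wedge[OF e len p])
  have L_lin: "linear L"
    by (intro linearI)
      (simp_all add: Finite_Cartesian_Product.vec_eq_iff L_entry distrib_right sum.distrib scaleR_sum_right)
  have p_Suc: "Suc (p - 1) = p" using p by simp
  have L_herm: "hermitian_mat (L k)" if k: "hermitian_mat k" for k
  proof -
    have coeff: "metric_coeff (form11 k) j i = cnj (metric_coeff (form11 k) i j)" for i j
      unfolding metric_coeff_form11 using k unfolding hermitian_mat_def by blast
    have "hermitian_qq (Suc (p - 1)) (wedge (form11 k) (wedge_power \<omega> (p - 1)))"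
      by (rule hermitian_qq_wedge[OF form11_support coeff pow(1)])
    then show ?thesis unfolding L_def p_Suc by (rule hermitian_index_mat[OF e len])
  qed
  have A_herm: "hermitian_mat (A k)" if k: "hermitian_mat k" for k
    unfolding A_L
    by (intro hermitian_mat_add L_herm k hermitian_index_mat[OF e len] real_pp_form_hermitian \<Omega>)
  have A_diff: "A k = A h + L (k - h)" for k by (simp add: A_L linear_diff[OF L_lin])

  obtain v \<mu> where v: "pencil_diag W (A h) v \<mu>"
    using pencil_eigenbasis[OF A_herm[OF h] W W_pos] by blast
  \<comment> \<open>The eigenvalues are only determined up to their order, which \<open>f\<close> and \<open>\<Gamma>\<close> do not see.\<close>
  have eig: "\<exists>\<pi> :: 'k \<Rightarrow> 'k. bij \<pi> \<and> eigenvalues p \<omega> (perturbed p \<omega> \<Omega> k) = (\<chi> a. l (\<pi> a))"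
    if "pencil_diag W (A k) u l" for k u l
    by (rule eigenvalues_pencil_diag[OF e len that[unfolded W_def A_def]])
  have \<mu>: "(\<chi> a. \<mu> a) \<in> \<Gamma>"
  proof -
    obtain \<pi> :: "'k \<Rightarrow> 'k" where \<pi>: "bij \<pi>" "eigenvalues p \<omega> (perturbed p \<omega> \<Omega> h) = (\<chi> a. \<mu> (\<pi> a))"
      using eig[OF v] by blast
    have "(\<chi> a. (\<chi> a. \<mu> (\<pi> a)) $ Hilbert_Choice.inv \<pi> a) \<in> \<Gamma>"
      using \<Gamma>(2)[unfolded symmetric_set_def, rule_format, OF bij_imp_bij_inv[OF \<pi>(1)] adm] \<pi>(2) by simp
    then show ?thesis using \<pi>(1) by (simp add: bij_is_surj surj_f_inv_f)
  qed
  have G: "f (eigenvalues p \<omega> (perturbed p \<omega> \<Omega> k)) - r = f (\<chi> a. l a) - r"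
    if u: "pencil_diag W (A k) u l" and l: "(\<chi> a. l a) \<in> \<Gamma>" for k u l
  proof -
    obtain \<pi> :: "'k \<Rightarrow> 'k" where \<pi>: "bij \<pi>" "eigenvalues p \<omega> (perturbed p \<omega> \<Omega> k) = (\<chi> a. l (\<pi> a))"
      using eig[OF u] by blast
    have "f (\<chi> a. (\<chi> a. l a) $ \<pi> a) = f (\<chi> a. l a)"
      using f(2) l \<pi>(1) unfolding symmetric_function_on_def by blast
    then show ?thesis using \<pi>(2) by simp
  qed
  define F where "F = (\<lambda>x. f x - r)"
  define d where "d = (\<lambda>a. partial_deriv f a (\<chi> i. \<mu> i))"
  have d0: "d a \<ge> 0" for a unfolding d_def by (rule f(3)[OF \<mu>])
  have F_deriv: "partial_deriv F a (\<chi> i. \<mu> i) = d a" for a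
  proof -
    have "(F has_derivative frechet_derivative f (at (\<chi> i. \<mu> i))) (at (\<chi> i. \<mu> i))"
      unfolding F_def using f(1)[OF \<mu>] frechet_derivative_works
      by (intro has_derivative_eq_rhs[OF has_derivative_diff[OF _ has_derivative_const]]) auto
    then show ?thesis by (simp add: partial_deriv_def d_def frechet_derivative_at[symmetric])
  qed
  have deriv: "((\<lambda>k. f (eigenvalues p \<omega> (perturbed p \<omega> \<Omega> k)) - r) has_derivative
      (\<lambda>k. \<Sum>a\<in>UNIV. partial_deriv F a (\<chi> i. \<mu> i) * Re (sesq (L k) (v a) (v a))))
      (at h within {k. hermitian_mat k})"
  proof (rule spectral_function_has_derivative[where W = W and A = A and \<Gamma> = \<Gamma> and f = F and A' = L])
    show "bounded_linear L" using L_lin by (simp add: linear_conv_bounded_linear)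
    show "F differentiable at (\<chi> a. \<mu> a)"
      unfolding F_def using f(1)[OF \<mu>] by (intro differentiable_diff differentiable_const)
    show "partial_deriv F a (\<chi> i. \<mu> i) = partial_deriv F b (\<chi> i. \<mu> i)" if "\<mu> a = \<mu> b" for a b
      unfolding F_deriv d_def using that by (intro partial_deriv_symmetric[OF \<Gamma>(1) \<mu> f(1)[OF \<mu>] f(2)]) simp
    show "f (eigenvalues p \<omega> (perturbed p \<omega> \<Omega> k)) - r = F (\<chi> a. l a)"
      if "pencil_diag W (A k) u l" "(\<chi> a. l a) \<in> \<Gamma>" for k u l
      unfolding F_def by (rule G[OF that])
    show "hermitian_mat (A k)" if "k \<in> {k. hermitian_mat k}" for k
      using that A_herm by simp
    show "h \<in> {k. hermitian_mat k}" using h by simp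
  qed (fact W W_pos A_diff v \<Gamma>(1) \<mu>)+

  define D :: "'n cmat" where
    "D = (\<chi> i j. \<Sum>a\<in>UNIV. of_real (d a) * sesq (wedge_mat p e \<omega> i j) (v a) (v a))"
  have D_sum: "(\<Sum>i\<in>UNIV. \<Sum>j\<in>UNIV. D $ i $ j * k $ i $ j) = (\<Sum>a\<in>UNIV. of_real (d a) * sesq (L k) (v a) (v a))" for k
  proof -
    let ?t = "\<lambda>i j a. of_real (d a) * (k $ i $ j * sesq (wedge_mat p e \<omega> i j) (v a) (v a))"
    have "(\<Sum>i\<in>UNIV. \<Sum>j\<in>UNIV. D $ i $ j * k $ i $ j) = (\<Sum>i\<in>UNIV. \<Sum>j\<in>UNIV. \<Sum>a\<in>UNIV. ?t i j a)"
      by (simp add: D_def sum_distrib_left sum_distrib_right mult_ac)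
    also have "\<dots> = (\<Sum>i\<in>UNIV. \<Sum>a\<in>UNIV. \<Sum>j\<in>UNIV. ?t i j a)" by (intro sum.cong refl sum.swap)
    also have "\<dots> = (\<Sum>a\<in>UNIV. \<Sum>i\<in>UNIV. \<Sum>j\<in>UNIV. ?t i j a)" by (rule sum.swap)
    also have "\<dots> = (\<Sum>a\<in>UNIV. of_real (d a) * sesq (L k) (v a) (v a))"
      by (simp add: L_sesq sum_distrib_left)
    finally show ?thesis .
  qed
  have D_herm: "hermitian_mat D"
    unfolding hermitian_mat_def
  proof (intro allI)
    fix i j
    show "D $ j $ i = cnj (D $ i $ j)"
      unfolding D_def by (simp add: sesq_wedge_mat_cnj[OF e len pow(1), where j = j and i = i])
  qed
  have "has_gradient_matrix (\<lambda>k. f (eigenvalues p \<omega> (perturbed p \<omega> \<Omega> k)) - r) D h"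
    unfolding has_gradient_matrix_def
    using D_herm deriv by (simp add: D_sum F_deriv)
  moreover have "pos_semidefinite D"
    unfolding pos_semidefinite_def
  proof (intro conjI allI D_herm)
    fix \<xi> :: "complex ^ ('n::{finite,linorder})"
    \<comment> \<open>\<open>D\<close> is tested against the rank-one direction \<open>\<xi> \<otimes> cnj \<xi>\<close>.\<close>
    define k :: "'n cmat" where "k = (\<chi> i j. \<xi> $ i * cnj (\<xi> $ j))"
    have rank1: "metric_coeff (form11 k) i j = (\<Sum>_\<in>{()}. \<xi> $ i * cnj (\<xi> $ j))" for i j
      by (simp add: metric_coeff_form11 k_def)
    have "nonneg_qq (Suc (p - 1)) (wedge (form11 k) (wedge_power \<omega> (p - 1)))"
      by (rule nonneg_qq_wedge[where S = "{()}" and a = "\<lambda>_ i. \<xi> $ i", OF form11_support rank1 pow(2)])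
    then have "Re (sesq (L k) x x) \<ge> 0" for x
      unfolding L_def p_Suc by (rule nonneg_index_mat[OF e len])
    then have "Re (\<Sum>a\<in>UNIV. of_real (d a) * sesq (L k) (v a) (v a)) \<ge> 0"
      using d0 by (simp add: sum_nonneg)
    then show "Re (\<Sum>i\<in>UNIV. \<Sum>j\<in>UNIV. D $ i $ j * \<xi> $ i * cnj (\<xi> $ j)) \<ge> 0"
      unfolding D_sum[symmetric] by (simp add: k_def mult.assoc)
  qed
  ultimately show ?thesis by blast
qed

lemma closed_hermitian_mat: "closed {k :: 'n::finite cmat. hermitian_mat k}"
proof -
  have "{k :: 'n cmat. hermitian_mat k} = (\<Inter>i. \<Inter>j. {k. k $ j $ i = cnj (k $ i $ j)})"
    by (auto simp: hermitian_mat_def)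
  moreover have "closed {k :: 'n cmat. k $ j $ i = cnj (k $ i $ j)}" for i j
    by (intro closed_Collect_eq continuous_intros)
  ultimately show ?thesis by (simp add: closed_INT)
qed

text \<open>Off the closed set of Hermitian matrices, the derivative within that set is no condition.\<close>

lemma has_gradient_matrix_outside:
  assumes "\<not> hermitian_mat h"
  shows "has_gradient_matrix G 0 h"
proof -
  have "at h within {k. hermitian_mat k} = bot"
    unfolding trivial_limit_within using closed_hermitian_mat assms closed_limpt by blast
  then show ?thesis
    by (simp add: has_gradient_matrix_def hermitian_mat_def has_derivative_def)
qed

theorem proposition1p1:
  fixes X :: "'m topology"
    and A :: "('m, 'n::{finite,linorder}) chart set"
    and \<omega> \<Omega> :: "('m, 'n) form_field"
    and \<psi> :: "'m \<Rightarrow> real"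
    and p :: nat
    and \<Gamma> :: "(real^'N) set"
    and f :: "real^'N \<Rightarrow> real"
  assumes "compact_complex_manifold X A" and "hermitian_metric_on A \<omega>"
    and "CARD('n) \<ge> 2" and "2 \<le> p" and "p \<le> CARD('n) - 1"
    and "CARD('N) = CARD('n) choose p"
    and "real_pp_form_on A p \<Omega>"
    and "open \<Gamma>" and "convex \<Gamma>" and "symmetric_set \<Gamma>"
    and "\<And>\<Lambda> c. \<Lambda> \<in> \<Gamma> \<Longrightarrow> c > 0 \<Longrightarrow> c *\<^sub>R \<Lambda> \<in> \<Gamma>"
    and "{\<Lambda>. \<forall>i. \<Lambda> $ i > 0} \<subseteq> \<Gamma>"
    and "smooth_on \<Gamma> f" and "symmetric_function_on \<Gamma> f"
    and "\<And>\<Lambda> i. \<Lambda> \<in> \<Gamma> \<Longrightarrow> partial_deriv f i \<Lambda> \<ge> 0"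
  shows "degenerate_parabolic_flow A p \<omega> \<Omega> f \<Gamma> \<psi>"
  unfolding degenerate_parabolic_flow_def
proof (intro allI impI)
  fix \<phi> assume adm: "admissible A p \<omega> \<Omega> \<Gamma> \<phi>"
  have diff: "f differentiable (at x)" if "x \<in> \<Gamma>" for x
  proof -
    have "Ck_on (Suc 0) \<Gamma> f" using \<open>smooth_on \<Gamma> f\<close> by (simp add: smooth_on_def del: Ck_on.simps)
    then show ?thesis using that by simp
  qed
  have "\<exists>D. has_gradient_matrix (flow_rhs p \<omega> \<Omega> f \<psi> (U, z) x) D
             (complex_hessian (\<lambda>y. \<phi> (inv_into U z y) t) (z x)) \<and> pos_semidefinite D"
    if c: "(U, z) \<in> A" and x: "x \<in> U" and t: "t > 0" for U z x t
  proof -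
    let ?h = "complex_hessian (\<lambda>y. \<phi> (inv_into U z y) t) (z x)"
    show ?thesis
    proof (cases "hermitian_mat ?h")
      case True
      have 1: "real_pp_form 1 (\<omega> (U, z) x)"
        using \<open>hermitian_metric_on A \<omega>\<close> c x unfolding hermitian_metric_on_def real_pp_form_on_def by blast
      have 2: "real_pp_form p (\<Omega> (U, z) x)"
        using \<open>real_pp_form_on A p \<Omega>\<close> c x unfolding real_pp_form_on_def by blast
      have 3: "eigenvalues p (\<omega> (U, z) x) (perturbed p (\<omega> (U, z) x) (\<Omega> (U, z) x) ?h) \<in> \<Gamma>"
        using adm c x t unfolding admissible_def by blast
      show ?thesis
        unfolding flow_rhs_def[abs_def]
      proof (rule gradient_exists_at_point[OF assms(6) _ 1 _ 2 assms(8,10) _ assms(14) _ True 3])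
        show "1 \<le> p" using \<open>2 \<le> p\<close> by simp
        show "Re (\<Sum>i\<in>UNIV. \<Sum>j\<in>UNIV. metric_coeff (\<omega> (U, z) x) i j * \<xi> $ i * cnj (\<xi> $ j)) > 0"
          if "\<xi> \<noteq> 0" for \<xi>
          using \<open>hermitian_metric_on A \<omega>\<close> c x that unfolding hermitian_metric_on_def by blast
      qed (fact diff assms(15))+
    next
      \<comment> \<open>The Hessian of a \<open>C\<^sup>2\<close> function is Hermitian, so this case does not arise; as the condition on
        \<open>D\<close> would be void, this need not be proved.\<close>
      case False
      have "pos_semidefinite (0 :: 'n cmat)" by (simp add: pos_semidefinite_def hermitian_mat_def)
      then show ?thesis using has_gradient_matrix_outside[OF False] by blast
    qed
  qed
  then show "\<forall>(U, z)\<in>A. \<forall>x\<in>U. \<forall>t>0. \<exists>D. has_gradient_matrix (flow_rhs p \<omega> \<Omega> f \<psi> (U, z) x) D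
             (complex_hessian (\<lambda>y. \<phi> (inv_into U z y) t) (z x)) \<and> pos_semidefinite D"
    by auto
qed

end
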